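(* Let $p>1$ and $q:=\frac{p}{p-1}$. For any $r<q$ there exist a bounded $C^1$ domain $\Omega\subset\mathbb{R}^2$ and a constant $c_r>0$ such that for all sufficiently large $\alpha$ there holds $$\big|\Lambda(\alpha)-(1-p)\alpha^q\big|\ge c_r\,\alpha^r,$$ where, for $\alpha>0$, $$\Lambda(\alpha):=\inf_{u\in W^{1,p}(\Omega),\,u\not\equiv 0}\frac{\int_\Omega|\nabla u|^p\,\mathrm{d}x-\alpha\int_{\partial\Omega}|u|^p\,\mathrm{d}s}{\int_\Omega|u|^p\,\mathrm{d}x}.$$
   Context: Here $\mathrm{d}s$ is the hypersurface measure (arc length for $n=2$) on $\partial\Omega$, and in the integral over $\partial\Omega$ the function $u\in W^{1,p}(\Omega)$ is understood in the sense of its boundary trace. A bounded domain $\Omega\subset\mathbb{R}^n$ is of class $C^1$ if each point of $\partial\Omega$ has an open neighborhood $V$ such that, in suitable orthogonal coordinates $y=(y',y_n)$, $y'=(y_1,\dots,y_{n-1})$, one has $V=\{y:\ y'\in V',\ y_n\in(-a_n,a_n)\}$ with $V'=(-a_1,a_1)\times\dots\times(-a_{n-1},a_{n-1})$ and some $a_1,\dots,a_n>0$, and there is a $C^1$ function $\varphi:V'\to\mathbb{R}$ with $|\varphi(y')|\le\frac12 a_n$ for all $y'\in V'$, $\Omega\cap V=\{y\in V:\ y_n<\varphi(y')\}$ and $\partial\Omega\cap V=\{y\in V:\ y_n=\varphi(y')\}$. *)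

theory Defs
  imports "HOL-Analysis.Analysis"
begin

definition partial_deriv :: "'n \<Rightarrow> (real ^ 'n \<Rightarrow> real) \<Rightarrow> real ^ 'n \<Rightarrow> real" where
  "partial_deriv i f x = frechet_derivative f (at x) (axis i 1)"

definition grad :: "(real ^ 'n \<Rightarrow> real) \<Rightarrow> real ^ 'n \<Rightarrow> real ^ 'n" where
  "grad f x = (\<chi> i. partial_deriv i f x)"

primrec Ck :: "nat \<Rightarrow> (real ^ 'n \<Rightarrow> real) \<Rightarrow> bool" where
  "Ck 0 f \<longleftrightarrow> continuous_on UNIV f"
| "Ck (Suc k) f \<longleftrightarrow> (\<forall>x. f differentiable (at x)) \<and> (\<forall>i. Ck k (partial_deriv i f))"

definition smooth :: "(real ^ 'n \<Rightarrow> real) \<Rightarrow> bool" where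
  "smooth f \<longleftrightarrow> (\<forall>k. Ck k f)"

definition test_function :: "(real ^ 'n) set \<Rightarrow> (real ^ 'n \<Rightarrow> real) \<Rightarrow> bool" where
  "test_function \<Omega> \<psi> \<longleftrightarrow>
     smooth \<psi> \<and> compact (closure {x. \<psi> x \<noteq> 0}) \<and> closure {x. \<psi> x \<noteq> 0} \<subseteq> \<Omega>"

text \<open>Here \<open>b\<close> is the origin of the orthogonal coordinates \<open>y = Q (x - b)\<close>; it need not be the
  boundary point \<open>x0\<close>, which only has to lie in the coordinate box \<open>V\<close>.\<close>

definition C1_domain :: "(real ^ 2) set \<Rightarrow> bool" where
  "C1_domain \<Omega> \<longleftrightarrow>
     open \<Omega> \<and> connected \<Omega> \<and> \<Omega> \<noteq> {} \<and>
     (\<forall>x0 \<in> frontier \<Omega>. \<exists>Q b a1 a2 \<phi>.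
        let y = (\<lambda>x. Q (x - b));
            V = {x. y x $ 1 \<in> {-a1<..<a1} \<and> y x $ 2 \<in> {-a2<..<a2}}
        in orthogonal_transformation (Q :: real ^ 2 \<Rightarrow> real ^ 2) \<and>
           a1 > 0 \<and> a2 > 0 \<and> x0 \<in> V \<and>
           (\<phi> :: real \<Rightarrow> real) C1_differentiable_on {-a1<..<a1} \<and>
           (\<forall>t \<in> {-a1<..<a1}. \<bar>\<phi> t\<bar> \<le> a2 / 2) \<and>
           \<Omega> \<inter> V = {x \<in> V. y x $ 2 < \<phi> (y x $ 1)} \<and>
           frontier \<Omega> \<inter> V = {x \<in> V. y x $ 2 = \<phi> (y x $ 1)})"

text \<open>Arc length is rendered as the one-dimensional Hausdorff measure, which needs no normalising
  constant and on a \<open>C\<^sup>1\<close> graph has density \<open>sqrt (1 + \<phi>'\<^sup>2)\<close> with respect to the parameter.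
  Boundedness of the covering sets is required because \<open>diameter\<close> is real-valued and meaningless
  for unbounded sets. The outer measure is countably additive on Borel sets (Caratheodory's
  criterion), so \<open>measure_of\<close> assigns these values to them.\<close>

definition hausdorff1_outer :: "'a::metric_space set \<Rightarrow> ennreal" where
  "hausdorff1_outer A =
     (SUP \<delta> \<in> {0::real<..}.
        INF C \<in> {C :: nat \<Rightarrow> 'a set. A \<subseteq> (\<Union>i. C i) \<and> (\<forall>i. bounded (C i) \<and> diameter (C i) \<le> \<delta>)}.
          \<Sum>i. ennreal (diameter (C i)))"

definition hausdorff1 :: "'a::metric_space measure" where
  "hausdorff1 = measure_of UNIV (sets borel) hausdorff1_outer"

definition boundary_measure :: "(real ^ 2) set \<Rightarrow> (real ^ 2) measure" where
  "boundary_measure \<Omega> = restrict_space hausdorff1 (frontier \<Omega>)"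

definition Lp :: "real \<Rightarrow> 'a measure \<Rightarrow> ('a \<Rightarrow> 'b::real_normed_vector) set" where
  "Lp p M = {f \<in> borel_measurable M. integrable M (\<lambda>x. norm (f x) powr p)}"

definition Lp_tendsto ::
    "real \<Rightarrow> 'a measure \<Rightarrow> (nat \<Rightarrow> 'a \<Rightarrow> 'b::real_normed_vector) \<Rightarrow> ('a \<Rightarrow> 'b) \<Rightarrow> bool" where
  "Lp_tendsto p M F f \<longleftrightarrow>
     (\<lambda>k. \<integral>\<^sup>+x. ennreal (norm (F k x - f x) powr p) \<partial>M) \<longlonglongrightarrow> 0"

definition weak_gradient ::
    "(real ^ 'n) set \<Rightarrow> (real ^ 'n \<Rightarrow> real) \<Rightarrow> (real ^ 'n \<Rightarrow> real ^ 'n) \<Rightarrow> bool" where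
  "weak_gradient \<Omega> u G \<longleftrightarrow>
     (\<forall>\<psi> i. test_function \<Omega> \<psi> \<longrightarrow>
        (LINT x|lebesgue_on \<Omega>. u x * partial_deriv i \<psi> x) =
        - (LINT x|lebesgue_on \<Omega>. G x $ i * \<psi> x))"

text \<open>\<open>u\<close> belongs to \<open>W\<^sup>1\<^sup>,\<^sup>p(\<Omega>)\<close> if it has a gradient in the following sense; such a gradient is
  unique up to null sets.\<close>

definition W1p_gradient ::
    "real \<Rightarrow> (real ^ 'n) set \<Rightarrow> (real ^ 'n \<Rightarrow> real) \<Rightarrow> (real ^ 'n \<Rightarrow> real ^ 'n) \<Rightarrow> bool" where
  "W1p_gradient p \<Omega> u G \<longleftrightarrow>
     u \<in> Lp p (lebesgue_on \<Omega>) \<and> G \<in> Lp p (lebesgue_on \<Omega>) \<and> weak_gradient \<Omega> u G"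

definition W1p :: "real \<Rightarrow> (real ^ 'n) set \<Rightarrow> (real ^ 'n \<Rightarrow> real) set" where
  "W1p p \<Omega> = {u. \<exists>G. W1p_gradient p \<Omega> u G}"

text \<open>The trace operator is the continuous extension to \<open>W\<^sup>1\<^sup>,\<^sup>p(\<Omega>)\<close>, with values in \<open>L\<^sup>p(\<partial>\<Omega>)\<close>, of
  the restriction of smooth functions to \<open>\<partial>\<Omega>\<close>; the relation below is its graph. For bounded
  \<open>C\<^sup>1\<close> domains every \<open>u\<close> in \<open>W\<^sup>1\<^sup>,\<^sup>p(\<Omega>)\<close> has a trace, unique up to null sets.\<close>

definition boundary_trace ::
    "real \<Rightarrow> (real ^ 2) set \<Rightarrow> (real ^ 2 \<Rightarrow> real) \<Rightarrow> (real ^ 2 \<Rightarrow> real) \<Rightarrow> bool" where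
  "boundary_trace p \<Omega> u g \<longleftrightarrow>
     g \<in> Lp p (boundary_measure \<Omega>) \<and>
     (\<exists>G U. W1p_gradient p \<Omega> u G \<and> (\<forall>k. smooth (U k)) \<and>
        Lp_tendsto p (lebesgue_on \<Omega>) U u \<and>
        Lp_tendsto p (lebesgue_on \<Omega>) (\<lambda>k. grad (U k)) G \<and>
        Lp_tendsto p (boundary_measure \<Omega>) U g)"

definition robin_quotient ::
    "real \<Rightarrow> (real ^ 2) set \<Rightarrow> real \<Rightarrow> (real ^ 2 \<Rightarrow> real) \<Rightarrow> (real ^ 2 \<Rightarrow> real ^ 2) \<Rightarrow>
     (real ^ 2 \<Rightarrow> real) \<Rightarrow> real" where
  "robin_quotient p \<Omega> \<alpha> u G g =
     ((LINT x|lebesgue_on \<Omega>. norm (G x) powr p)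
        - \<alpha> * (LINT x|boundary_measure \<Omega>. \<bar>g x\<bar> powr p))
     / (LINT x|lebesgue_on \<Omega>. \<bar>u x\<bar> powr p)"

text \<open>Since the weak gradient and the trace of \<open>u\<close> are unique up to null sets, ranging over all
  their representatives does not change the infimum over \<open>u\<close>. It is taken in the extended reals,
  where it exists without any a priori lower bound.\<close>

definition robin_Lambda :: "real \<Rightarrow> (real ^ 2) set \<Rightarrow> real \<Rightarrow> ereal" where
  "robin_Lambda p \<Omega> \<alpha> =
     Inf {ereal (robin_quotient p \<Omega> \<alpha> u G g) | u G g.
            u \<in> W1p p \<Omega> \<and> \<not> (AE x in lebesgue_on \<Omega>. u x = 0) \<and>
            W1p_gradient p \<Omega> u G \<and> boundary_trace p \<Omega> u g}"

end

theory Submission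
  imports Defs
begin

text \<open>An upper bound for \<open>\<Lambda>(\<alpha>)\<close> needs only one competitor. The domain is the superdisc
\<open>|x1|\<^sup>s + |x2|\<^sup>s < 1\<close> with \<open>s > 1\<close> close to \<open>1\<close>, which is \<open>C\<^sup>1\<close> but, for \<open>s < 2\<close>, has infinite curvature at the top
\<open>(0, 1)\<close>; the competitor is \<open>u(x) = exp (\<mu> x2)\<close> with \<open>\<mu> = \<alpha>\<close> to the power \<open>q - 1\<close>, so that
\<open>\<mu>\<^sup>p = \<alpha>\<^sup>q = \<alpha> \<mu>\<close>.

Since \<open>|\<nabla>u| = \<mu> u\<close>, the Robin quotient of \<open>u\<close> is \<open>\<alpha>\<^sup>q - \<alpha> B / I\<close>, where \<open>I\<close> and \<open>B\<close> are the integrals of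
\<open>exp (k x2)\<close>, \<open>k = p \<mu>\<close>, over the domain and over its boundary. The upper half of the boundary is the
graph of a profile \<open>\<phi>\<close> on \<open>(-1, 1)\<close>. Integrating first in the direction of \<open>x2\<close> gives
\<open>k I \<le> W\<close> with \<open>W = \<integral> exp (k \<phi>)\<close>, whereas \<open>B \<ge> \<integral> sqrt (1 + \<phi>'\<^sup>2) exp (k \<phi>)\<close>. If one drops \<open>\<phi>'\<close>, the quotient
is at most \<open>\<alpha>\<^sup>q - p \<alpha> \<mu> = (1 - p) \<alpha>\<^sup>q\<close>; the slope of the profile yields the gain.

The gain is quantified at a single scale. Near the top \<open>\<phi>(t)\<close> is about \<open>1 - |t|\<^sup>s / s\<close>, so the weight
\<open>exp (k \<phi>)\<close> lives on \<open>|t|\<close> of order \<open>a\<close>, where \<open>\<mu> a\<^sup>s = 1\<close>. A fixed proportion of \<open>W\<close> therefore comes from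
\<open>[a, 2a]\<close> (\<open>superdisc_weight_concentration\<close>), and there the slope is at least \<open>m = a\<close> to the power
\<open>s - 1\<close>. Hence \<open>B / (k I) \<ge> 1 + const * m\<^sup>2\<close> (\<open>superdisc_boundary_interior_ratio\<close>), and \<open>\<Lambda>(\<alpha>)\<close> lies below
\<open>(1 - p) \<alpha>\<^sup>q\<close> by at least a constant times \<open>\<alpha>\<^sup>q m\<^sup>2\<close>, which is \<open>\<alpha>\<close> to the power
\<open>q - 2 (q - 1) (s - 1) / s\<close>. As \<open>s\<close> tends to \<open>1\<close> this exponent tends to \<open>q\<close>, so it exceeds any given \<open>r < q\<close>.

Arc length is the one-dimensional Hausdorff measure, and its estimates come straight from covers: it is a
measure on the Borel sets (\<open>emeasure_hausdorff1\<close>), a set which a real function \<open>T\<close> shrinks by a factor \<open>K\<close> has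
length at least \<open>K\<close> times the length of its image (\<open>nn_integral_hausdorff1_ge\<close>), and Lipschitz
curves have finite length (\<open>hausdorff1_outer_lipschitz_interval\<close>). For a graph whose slope is at least
\<open>m\<close>, the projection \<open>T\<close> to the first coordinate shrinks by \<open>sqrt (1 + m\<^sup>2)\<close>.\<close>

section \<open>Metric outer measures\<close>

lemma outer_measure_space_Un:
  assumes oms: "outer_measure_space UNIV \<mu>" and disj: "A \<inter> B = {}"
  shows "\<mu> (A \<union> B) \<le> \<mu> A + \<mu> B"
proof -
  have "disjoint_family (binaryset A B)"
    using disj by (auto simp: disjoint_family_on_def binaryset_def split: if_splits)
  then have "\<mu> (\<Union>i. binaryset A B i) \<le> (\<Sum>i. \<mu> (binaryset A B i))"
    using oms by (auto simp: outer_measure_space_def countably_subadditive_def)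
  also have "\<dots> = \<mu> A + \<mu> B"
    by (rule suminf_binaryset_eq) (use oms in \<open>simp add: outer_measure_space_def positive_def\<close>)
  finally show ?thesis by (simp add: UN_binaryset_eq)
qed

text \<open>Caratheodory's criterion for closed sets. The part of \<open>X\<close> at distance at least \<open>1 / (n + 1)\<close> from \<open>F\<close> is
separated from \<open>X \<inter> F\<close>, so additivity holds for these two pieces; the point is that this part exhausts
\<open>X - F\<close> in measure. The remainder is a union of shells. Shells whose indices differ by two are separated,
so the even ones, and likewise the odd ones, have total measure at most \<open>\<mu> X\<close>: the shells form a convergent
series and its tails vanish.\<close>

lemma metric_outer_measure_closed_measurable:
  fixes \<mu> :: "'a::metric_space set \<Rightarrow> ennreal"
  assumes oms: "outer_measure_space UNIV \<mu>"
    and sep: "\<And>A B d. d > 0 \<Longrightarrow> \<forall>a\<in>A. \<forall>b\<in>B. d \<le> dist a b \<Longrightarrow>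
                \<mu> A + \<mu> B \<le> \<mu> (A \<union> B)"
    and "closed F"
  shows "\<mu> (X \<inter> F) + \<mu> (X - F) \<le> \<mu> X"
proof (cases "F = {} \<or> \<mu> X = \<infinity>")
  case True
  have "\<mu> {} = 0"
    using oms by (simp add: outer_measure_space_def positive_def)
  with True show ?thesis by auto
next
  case False
  have mono: "\<mu> A \<le> \<mu> B" if "A \<subseteq> B" for A B
    using oms that by (auto simp: outer_measure_space_def increasing_def)
  have empty: "\<mu> {} = 0"
    using oms by (simp add: outer_measure_space_def positive_def)
  have subadd: "\<mu> (\<Union>i. A i) \<le> (\<Sum>i. \<mu> (A i))" if "disjoint_family A" for A :: "nat \<Rightarrow> _"
    using oms that by (auto simp: outer_measure_space_def countably_subadditive_def)
  define f where "f x = infdist x F" for x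
  define e :: "nat \<Rightarrow> real" where "e n = 1 / (real n + 1)" for n
  have e_pos: "e n > 0" for n by (simp add: e_def)
  have e_less: "e n < e m" if "m < n" for m n
    using that by (simp add: e_def divide_simps)
  have e_le: "e n \<le> e m" if "m \<le> n" for m n
    using that by (simp add: e_def divide_simps)
  have f_diff: "f x - f y \<le> dist x y" for x y
    using infdist_triangle[of x F y] by (simp add: f_def)
  have f_0: "f x = 0 \<longleftrightarrow> x \<in> F" for x
    using in_closed_iff_infdist_zero[of F x] False \<open>closed F\<close> by (simp add: f_def)
  have f_ge: "f x \<ge> 0" for x by (simp add: f_def infdist_nonneg)
  define A where "A n = {x \<in> X. e n \<le> f x}" for n
  \<comment> \<open>the shells around \<open>F\<close>; \<open>A n\<close> together with the shells from index \<open>n\<close> on is \<open>X - F\<close>\<close>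
  define R where "R n = {x \<in> X. e (Suc n) \<le> f x \<and> f x < e n}" for n
  have fin: "\<mu> (R n) < \<infinity>" for n
    using mono[of "R n" X] False by (auto simp: R_def top.not_eq_extremum)
  have alternate: "(\<Sum>k<n. \<mu> (R (2 * k + j))) \<le> \<mu> (\<Union>k<n. R (2 * k + j))" for n j
  proof (induction n)
    case 0 then show ?case by simp
  next
    case (Suc n)
    have "(\<Sum>k<Suc n. \<mu> (R (2 * k + j))) \<le> \<mu> (\<Union>k<n. R (2 * k + j)) + \<mu> (R (2 * n + j))"
      using Suc by (simp add: add_right_mono)
    also have "\<dots> \<le> \<mu> ((\<Union>k<n. R (2 * k + j)) \<union> R (2 * n + j))"
    proof (cases "n = 0")
      case True then show ?thesis by (simp add: empty)
    next
      case n: False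
      show ?thesis
      proof (rule sep)
        show "e (2 * n + j - 1) - e (2 * n + j) > 0"
          using n e_less[of "2 * n + j - 1" "2 * n + j"] by simp
        show "\<forall>a\<in>(\<Union>k<n. R (2 * k + j)). \<forall>b\<in>R (2 * n + j). e (2 * n + j - 1) - e (2 * n + j) \<le> dist a b"
        proof (intro ballI)
          fix a b assume "a \<in> (\<Union>k<n. R (2 * k + j))" and b: "b \<in> R (2 * n + j)"
          then obtain k where k: "k < n" "a \<in> R (2 * k + j)" by auto
          have "e (2 * n + j - 1) \<le> e (Suc (2 * k + j))" using k by (intro e_le) auto
          then have "e (2 * n + j - 1) \<le> f a" using k by (auto simp: R_def)
          then show "e (2 * n + j - 1) - e (2 * n + j) \<le> dist a b"
            using b f_diff[of a b] by (auto simp: R_def)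
        qed
      qed
    qed
    also have "(\<Union>k<n. R (2 * k + j)) \<union> R (2 * n + j) = (\<Union>k<Suc n. R (2 * k + j))"
      by (auto simp: lessThan_Suc)
    finally show ?case .
  qed
  have bounded_sum: "(\<Sum>k<n. enn2real (\<mu> (R k))) \<le> 2 * enn2real (\<mu> X)" for n
  proof -
    have half: "(\<Sum>k<n. enn2real (\<mu> (R (2 * k + j)))) \<le> enn2real (\<mu> X)" for n j
    proof -
      have "(\<Sum>k<n. \<mu> (R (2 * k + j))) \<le> \<mu> X"
        using alternate[where n = n and j = j] mono[of "\<Union>k<n. R (2 * k + j)" X] by (force simp: R_def)
      then have "enn2real (\<Sum>k<n. \<mu> (R (2 * k + j))) \<le> enn2real (\<mu> X)"
        using False by (intro enn2real_mono) (auto simp: top.not_eq_extremum)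
      then show ?thesis by (subst (asm) enn2real_sum) (use fin in auto)
    qed
    \<comment> \<open>extend the range to \<open>2 n\<close> to pair even and odd shells\<close>
    have "(\<Sum>k<n. enn2real (\<mu> (R k))) \<le> (\<Sum>k<n + n. enn2real (\<mu> (R k)))"
      by (intro sum_mono2) auto
    also have "\<dots> = (\<Sum>k<n. enn2real (\<mu> (R (2 * k)))) + (\<Sum>k<n. enn2real (\<mu> (R (2 * k + 1))))"
      by (induction n) (auto simp: algebra_simps mult_2_right)
    finally show ?thesis using half[where n = n and j = 0] half[where n = n and j = 1] by simp
  qed
  have summ: "summable (\<lambda>k. enn2real (\<mu> (R k)))"
    by (rule bounded_imp_summable[where B = "2 * enn2real (\<mu> X)"])
       (use bounded_sum in \<open>simp_all only: lessThan_Suc_atMost[symmetric] enn2real_nonneg\<close>)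
  show ?thesis
  proof (rule ennreal_le_epsilon)
    fix r :: real assume "0 < r"
    from suminf_exist_split[OF this summ] obtain n
      where n: "norm (\<Sum>k. enn2real (\<mu> (R (k + n)))) < r" by blast
    have "(\<Sum>k. \<mu> (R (k + n))) = (\<Sum>k. ennreal (enn2real (\<mu> (R (k + n)))))"
      by (intro suminf_cong) (use fin in auto)
    also have "\<dots> = ennreal (\<Sum>k. enn2real (\<mu> (R (k + n))))"
      by (intro suminf_ennreal2) (use summable_ignore_initial_segment[OF summ] in auto)
    also have "\<dots> \<le> ennreal r" using n by (intro ennreal_leI) auto
    finally have tail: "(\<Sum>k. \<mu> (R (k + n))) \<le> ennreal r" .
    have disj: "disjoint_family (\<lambda>k. R (k + n))"
    proof -
      have "R i \<inter> R j = {}" if "i < j" for i j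
        using e_le[of "Suc i" j] that by (auto simp: R_def)
      then have "R i \<inter> R j = {}" if "i \<noteq> j" for i j
        using that by (cases i j rule: linorder_cases) (auto simp: Int_commute)
      then show ?thesis by (auto simp: disjoint_family_on_def)
    qed
    have "X - F \<subseteq> A n \<union> (\<Union>k. R (k + n))"
    proof
      fix x assume x: "x \<in> X - F"
      then have "f x > 0" using f_0[of x] f_ge[of x] by (auto simp: less_le)
      show "x \<in> A n \<union> (\<Union>k. R (k + n))"
      proof (cases "e n \<le> f x")
        case True then show ?thesis using x by (auto simp: A_def)
      next
        case less: False
        obtain N where "inverse (real (Suc N)) < f x" using reals_Archimedean[OF \<open>f x > 0\<close>] by auto
        then have N: "e N \<le> f x" by (simp add: e_def field_simps)
        define m where "m = (LEAST m. e m \<le> f x)"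
        have m: "e m \<le> f x" unfolding m_def using N by (rule LeastI)
        have "m > n" using less m e_le[of m n] by (meson leI order_trans)
        then obtain k where k: "m = Suc (k + n)"
          by (metis add.commute less_imp_Suc_add)
        have "\<not> e (k + n) \<le> f x" using k not_less_Least[of "k + n" "\<lambda>m. e m \<le> f x"] by (simp add: m_def)
        then show ?thesis using m x by (auto simp: R_def k)
      qed
    qed
    then have "\<mu> (X - F) \<le> \<mu> (A n \<union> (\<Union>k. R (k + n)))" by (rule mono)
    also have "\<dots> \<le> \<mu> (A n) + \<mu> (\<Union>k. R (k + n))"
    proof (rule outer_measure_space_Un[OF oms])
      have "A n \<inter> R (k + n) = {}" for k using e_le[of n "k + n"] by (auto simp: A_def R_def)
      then show "A n \<inter> (\<Union>k. R (k + n)) = {}" by auto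
    qed
    also have "\<dots> \<le> \<mu> (A n) + r"
      using subadd[OF disj] tail by (intro add_left_mono) (rule order_trans)
    finally have 1: "\<mu> (X - F) \<le> \<mu> (A n) + r" .
    have "\<mu> (X \<inter> F) + \<mu> (A n) \<le> \<mu> ((X \<inter> F) \<union> A n)"
    proof (rule sep)
      show "e n > 0" by (rule e_pos)
      have "e n \<le> dist a b" if "a \<in> X \<inter> F" "b \<in> A n" for a b
        using that f_diff[of b a] f_0[of a] by (auto simp: A_def dist_commute)
      then show "\<forall>a\<in>X \<inter> F. \<forall>b\<in>A n. e n \<le> dist a b" by blast
    qed
    also have "\<dots> \<le> \<mu> X" by (rule mono) (auto simp: A_def)
    finally have 2: "\<mu> (X \<inter> F) + \<mu> (A n) \<le> \<mu> X" .
    have "\<mu> (X \<inter> F) + \<mu> (X - F) \<le> \<mu> (X \<inter> F) + (\<mu> (A n) + r)"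
      by (rule add_left_mono[OF 1])
    also have "\<dots> = \<mu> (X \<inter> F) + \<mu> (A n) + r" by (simp add: add.assoc)
    also have "\<dots> \<le> \<mu> X + r" by (rule add_right_mono[OF 2])
    finally show "\<mu> (X \<inter> F) + \<mu> (X - F) \<le> \<mu> X + r" .
  qed
qed

lemma metric_outer_measure_measure_space:
  fixes \<mu> :: "'a::metric_space set \<Rightarrow> ennreal"
  assumes oms: "outer_measure_space UNIV \<mu>"
    and sep: "\<And>A B d. d > 0 \<Longrightarrow> \<forall>a\<in>A. \<forall>b\<in>B. d \<le> dist a b \<Longrightarrow>
                \<mu> A + \<mu> B \<le> \<mu> (A \<union> B)"
  shows "measure_space UNIV (sets borel) \<mu>"
proof -
  interpret P: sigma_algebra UNIV "UNIV :: 'a set set"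
    using sigma_algebra_Pow[of "UNIV :: 'a set"] by simp
  define L where "L = lambda_system UNIV UNIV \<mu>"
  have ms: "measure_space UNIV L \<mu>"
    unfolding L_def by (rule P.caratheodory_lemma[OF oms])
  then have L: "sigma_algebra UNIV L" by (simp add: measure_space_def)
  have "F \<in> L" if F: "closed F" for F
  proof -
    have le: "\<mu> X \<le> \<mu> (X \<inter> F) + \<mu> (X - F)" for X
      using outer_measure_space_Un[OF oms, of "X \<inter> F" "X - F"] by (simp add: Int_Diff_disjoint Int_Diff_Un)
    have ge: "\<mu> (X \<inter> F) + \<mu> (X - F) \<le> \<mu> X" for X
      by (rule metric_outer_measure_closed_measurable[OF oms _ F]) (rule sep)
    have "\<mu> (X \<inter> F) + \<mu> (X - F) = \<mu> X" for X
      by (rule antisym[OF ge le])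
    then show "F \<in> L"
      by (simp add: L_def P.lambda_system_eq)
  qed
  then have "sigma_sets UNIV (Collect closed) \<subseteq> L"
    by (intro sigma_algebra.sigma_sets_subset[OF L]) auto
  then have sub: "sets (borel :: 'a measure) \<subseteq> L"
    by (simp add: borel_eq_closed)
  have "countably_additive (sets borel) \<mu>"
    unfolding countably_additive_def
  proof (intro allI impI)
    fix A :: "nat \<Rightarrow> 'a set"
    assume "range A \<subseteq> sets borel" "disjoint_family A" "(\<Union>i. A i) \<in> sets borel"
    with sub have "range A \<subseteq> L" "disjoint_family A" "(\<Union>i. A i) \<in> L" by auto
    with ms show "(\<Sum>i. \<mu> (A i)) = \<mu> (\<Union>i. A i)"
      by (simp add: measure_space_def countably_additive_def)
  qed
  moreover have "positive (sets borel) \<mu>"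
    using oms by (simp add: outer_measure_space_def positive_def)
  ultimately show ?thesis
    using sets.sigma_algebra_axioms[of "borel :: 'a measure"] by (simp add: measure_space_def)
qed

section \<open>The one-dimensional Hausdorff measure\<close>

text \<open>The supremum over \<open>\<delta>\<close> of these set functions is the Hausdorff outer measure. Countable subadditivity, and
additivity on sets at distance more than \<open>\<delta>\<close>, hold already for each fixed \<open>\<delta>\<close>.\<close>

definition hausdorff1_premeasure :: "real \<Rightarrow> 'a::metric_space set \<Rightarrow> ennreal" where
  "hausdorff1_premeasure \<delta> A =
     (INF C \<in> {C :: nat \<Rightarrow> 'a set. A \<subseteq> (\<Union>i. C i) \<and> (\<forall>i. bounded (C i) \<and> diameter (C i) \<le> \<delta>)}.
          \<Sum>i. ennreal (diameter (C i)))"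

lemma hausdorff1_outer_eq: "hausdorff1_outer A = (SUP \<delta>\<in>{0<..}. hausdorff1_premeasure \<delta> A)"
  by (simp add: hausdorff1_outer_def hausdorff1_premeasure_def)

lemma hausdorff1_premeasure_le_outer: "\<delta> > 0 \<Longrightarrow> hausdorff1_premeasure \<delta> A \<le> hausdorff1_outer A"
  unfolding hausdorff1_outer_eq by (rule SUP_upper) simp

lemma hausdorff1_premeasure_le:
  assumes "A \<subseteq> (\<Union>i. C i)" "\<And>i. bounded (C i)" "\<And>i. diameter (C i) \<le> \<delta>"
  shows "hausdorff1_premeasure \<delta> A \<le> (\<Sum>i. ennreal (diameter (C i)))"
  unfolding hausdorff1_premeasure_def by (rule INF_lower) (use assms in auto)

lemma hausdorff1_premeasure_antimono:
  assumes "\<delta> \<le> \<epsilon>" shows "hausdorff1_premeasure \<epsilon> A \<le> hausdorff1_premeasure \<delta> A"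
  unfolding hausdorff1_premeasure_def
  by (rule INF_superset_mono) (use assms in \<open>auto dest: spec intro: order_trans[of _ \<delta> \<epsilon>]\<close>)

lemma hausdorff1_premeasure_mono:
  "A \<subseteq> B \<Longrightarrow> hausdorff1_premeasure \<delta> A \<le> hausdorff1_premeasure \<delta> B"
  unfolding hausdorff1_premeasure_def
  by (rule INF_superset_mono) auto

lemma hausdorff1_premeasure_UN:
  fixes A :: "nat \<Rightarrow> 'a::metric_space set"
  shows "hausdorff1_premeasure \<delta> (\<Union>i. A i) \<le> (\<Sum>i. hausdorff1_premeasure \<delta> (A i))"
proof (rule ennreal_le_epsilon)
  fix e :: real assume fin: "(\<Sum>i. hausdorff1_premeasure \<delta> (A i)) < top" and e: "e > 0"
  have "\<exists>C. A i \<subseteq> (\<Union>j. C j) \<and> (\<forall>j. bounded (C j) \<and> diameter (C j) \<le> \<delta>) \<and>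
          (\<Sum>j. ennreal (diameter (C j))) \<le> hausdorff1_premeasure \<delta> (A i) + ennreal (e * (1/2)^Suc i)" for i
  proof -
    have "hausdorff1_premeasure \<delta> (A i) < top"
      using fin by (meson ennreal_suminf_lessD)
    then have "hausdorff1_premeasure \<delta> (A i) < hausdorff1_premeasure \<delta> (A i) + ennreal (e * (1/2)^Suc i)"
      using e ennreal_add_left_cancel_less[of "hausdorff1_premeasure \<delta> (A i)" 0] by simp
    then show ?thesis
      by (subst (asm) (1) hausdorff1_premeasure_def) (auto simp: INF_less_iff intro: less_imp_le)
  qed
  then obtain C where C: "\<And>i. A i \<subseteq> (\<Union>j. C i j)" "\<And>i j. bounded (C i j)" "\<And>i j. diameter (C i j) \<le> \<delta>"
    "\<And>i. (\<Sum>j. ennreal (diameter (C i j))) \<le> hausdorff1_premeasure \<delta> (A i) + ennreal (e * (1/2)^Suc i)"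
    by metis
  \<comment> \<open>the covers \<open>C i\<close> of the sets \<open>A i\<close>, each optimal up to \<open>e / 2\<close> to the power \<open>i + 1\<close>,
    are listed as one sequence\<close>
  have "hausdorff1_premeasure \<delta> (\<Union>i. A i) \<le> (\<Sum>n. ennreal (diameter (case_prod C (prod_decode n))))"
  proof (rule hausdorff1_premeasure_le)
    show "(\<Union>i. A i) \<subseteq> (\<Union>n. case_prod C (prod_decode n))"
    proof safe
      fix x i assume "x \<in> A i"
      then obtain j where "x \<in> C i j" using C(1) by blast
      then show "x \<in> (\<Union>n. case_prod C (prod_decode n))"
        by (intro UN_I[of "prod_encode (i, j)"]) auto
    qed
  qed (auto simp: C(2,3) split: prod.splits)
  also have "\<dots> = (\<Sum>i. \<Sum>j. ennreal (diameter (C i j)))"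
    by (subst suminf_ennreal_2dimen[where f = "\<lambda>p. ennreal (diameter (case_prod C p))"
          and g = "\<lambda>i. \<Sum>j. ennreal (diameter (C i j))"]) (auto simp: o_def split_def)
  also have "\<dots> \<le> (\<Sum>i. hausdorff1_premeasure \<delta> (A i) + ennreal (e * (1/2)^Suc i))"
    by (intro suminf_le C(4)) auto
  also have "\<dots> = (\<Sum>i. hausdorff1_premeasure \<delta> (A i)) + (\<Sum>i. ennreal (e * (1/2)^Suc i))"
    by (intro suminf_add[symmetric]) auto
  also have "(\<Sum>i. ennreal (e * (1/2)^Suc i)) = ennreal e"
    using sums_mult[OF power_half_series, of e] e by (intro suminf_ennreal_eq) auto
  finally show "hausdorff1_premeasure \<delta> (\<Union>i. A i) \<le> (\<Sum>i. hausdorff1_premeasure \<delta> (A i)) + ennreal e" .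
qed

text \<open>No covering set of diameter at most \<open>\<delta>\<close> meets both \<open>A\<close> and \<open>B\<close>, so a cover of the union splits into a cover
of each.\<close>

lemma hausdorff1_premeasure_separated:
  assumes d: "\<And>a b. a \<in> A \<Longrightarrow> b \<in> B \<Longrightarrow> \<delta> < dist a b"
  shows "hausdorff1_premeasure \<delta> A + hausdorff1_premeasure \<delta> B \<le> hausdorff1_premeasure \<delta> (A \<union> B)"
  unfolding hausdorff1_premeasure_def[of \<delta> "A \<union> B"]
proof (rule INF_greatest, safe)
  fix C :: "nat \<Rightarrow> 'a set"
  assume cov: "A \<union> B \<subseteq> (\<Union>i. C i)" and C: "\<forall>i. bounded (C i) \<and> diameter (C i) \<le> \<delta>"
  define CA where "CA i = (if C i \<inter> A = {} then {} else C i)" for i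
  define CB where "CB i = (if C i \<inter> A = {} then C i else {})" for i
  have "0 \<le> \<delta>" using C[rule_format, of 0] diameter_ge_0[of "C 0"] by simp
  have "hausdorff1_premeasure \<delta> A \<le> (\<Sum>i. ennreal (diameter (CA i)))"
  proof (rule hausdorff1_premeasure_le)
    show "A \<subseteq> (\<Union>i. CA i)" using cov by (fastforce simp: CA_def)
  qed (use C \<open>0 \<le> \<delta>\<close> in \<open>auto simp: CA_def\<close>)
  moreover have "hausdorff1_premeasure \<delta> B \<le> (\<Sum>i. ennreal (diameter (CB i)))"
  proof (rule hausdorff1_premeasure_le)
    show "B \<subseteq> (\<Union>i. CB i)"
    proof
      fix b assume b: "b \<in> B"
      then obtain i where i: "b \<in> C i" using cov by auto
      have "C i \<inter> A = {}"
      proof (rule ccontr)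
        assume "C i \<inter> A \<noteq> {}"
        then obtain a where a: "a \<in> C i" "a \<in> A" by auto
        have "dist a b \<le> \<delta>" using diameter_bounded_bound[of "C i" a b] C a i by (meson order_trans)
        with d[OF a(2) b] show False by simp
      qed
      then show "b \<in> (\<Union>i. CB i)" using i by (auto simp: CB_def)
    qed
  qed (use C \<open>0 \<le> \<delta>\<close> in \<open>auto simp: CB_def\<close>)
  ultimately have "hausdorff1_premeasure \<delta> A + hausdorff1_premeasure \<delta> B
      \<le> (\<Sum>i. ennreal (diameter (CA i))) + (\<Sum>i. ennreal (diameter (CB i)))"
    by (rule add_mono)
  also have "\<dots> = (\<Sum>i. ennreal (diameter (CA i)) + ennreal (diameter (CB i)))"
    by (rule suminf_add) auto
  also have "\<dots> = (\<Sum>i. ennreal (diameter (C i)))"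
    by (rule suminf_cong) (simp add: CA_def CB_def)
  finally show "hausdorff1_premeasure \<delta> A + hausdorff1_premeasure \<delta> B \<le> (\<Sum>i. ennreal (diameter (C i)))" .
qed

lemma outer_measure_space_hausdorff1:
  "outer_measure_space UNIV (hausdorff1_outer :: 'a::metric_space set \<Rightarrow> ennreal)"
proof -
  have "hausdorff1_premeasure \<delta> ({} :: 'a set) = 0" if "\<delta> > 0" for \<delta>
    using hausdorff1_premeasure_le[of "{} :: 'a set" "\<lambda>_. {}" \<delta>] that by simp
  then have "hausdorff1_outer ({} :: 'a set) = 0"
    by (auto simp: hausdorff1_outer_eq intro!: antisym SUP_least)
  moreover have "hausdorff1_outer A \<le> hausdorff1_outer B" if "A \<subseteq> B" for A B :: "'a set"
    unfolding hausdorff1_outer_eq by (rule SUP_mono') (rule hausdorff1_premeasure_mono[OF that])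
  moreover have "hausdorff1_outer (\<Union>i. A i) \<le> (\<Sum>i. hausdorff1_outer (A i))" for A :: "nat \<Rightarrow> 'a set"
    unfolding hausdorff1_outer_eq[of "\<Union>i. A i"]
  proof (rule SUP_least)
    fix \<delta> :: real assume "\<delta> \<in> {0<..}"
    then have "(\<Sum>i. hausdorff1_premeasure \<delta> (A i)) \<le> (\<Sum>i. hausdorff1_outer (A i))"
      by (intro suminf_le hausdorff1_premeasure_le_outer) auto
    then show "hausdorff1_premeasure \<delta> (\<Union>i. A i) \<le> (\<Sum>i. hausdorff1_outer (A i))"
      by (rule order_trans[OF hausdorff1_premeasure_UN])
  qed
  ultimately show ?thesis
    by (auto simp: outer_measure_space_def positive_def increasing_def countably_subadditive_def)
qed

lemma ennreal_SUP_add_le: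
  fixes f :: "'i \<Rightarrow> ennreal"
  assumes "I \<noteq> {}" "J \<noteq> {}" and le: "\<And>i j. i \<in> I \<Longrightarrow> j \<in> J \<Longrightarrow> f i + g j \<le> c"
  shows "(SUP i\<in>I. f i) + (SUP j\<in>J. g j) \<le> c"
proof -
  have "(SUP i\<in>I. f i) + g j \<le> c" if "j \<in> J" for j
    using le that by (subst ennreal_SUP_add_left[symmetric, OF \<open>I \<noteq> {}\<close>]) (intro SUP_least)
  then show ?thesis
    by (subst ennreal_SUP_add_right[OF \<open>J \<noteq> {}\<close>]) (intro SUP_least)
qed

lemma hausdorff1_outer_separated:
  assumes d: "d > 0" "\<forall>a\<in>A. \<forall>b\<in>B. d \<le> dist a b"
  shows "hausdorff1_outer A + hausdorff1_outer B \<le> hausdorff1_outer (A \<union> B)"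
proof -
  have "hausdorff1_premeasure \<delta> A + hausdorff1_premeasure \<epsilon> B \<le> hausdorff1_outer (A \<union> B)"
    if "\<delta> > 0" "\<epsilon> > 0" for \<delta> \<epsilon>
  proof -
    define \<gamma> where "\<gamma> = min (min \<delta> \<epsilon>) (d / 2)"
    have \<gamma>: "\<gamma> > 0" "\<gamma> \<le> \<delta>" "\<gamma> \<le> \<epsilon>" "\<gamma> < d" using that d(1) by (auto simp: \<gamma>_def)
    have "hausdorff1_premeasure \<delta> A + hausdorff1_premeasure \<epsilon> B
        \<le> hausdorff1_premeasure \<gamma> A + hausdorff1_premeasure \<gamma> B"
      by (intro add_mono hausdorff1_premeasure_antimono \<gamma>)
    also have "\<dots> \<le> hausdorff1_premeasure \<gamma> (A \<union> B)"
      by (rule hausdorff1_premeasure_separated) (use d(2) \<gamma>(4) in force)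
    also have "\<dots> \<le> hausdorff1_outer (A \<union> B)"
      by (rule hausdorff1_premeasure_le_outer) fact
    finally show ?thesis .
  qed
  then show ?thesis
    unfolding hausdorff1_outer_eq[of A] hausdorff1_outer_eq[of B]
    by (intro ennreal_SUP_add_le) auto
qed

lemma sets_hausdorff1 [simp, measurable_cong]: "sets (hausdorff1 :: 'a::metric_space measure) = sets borel"
  unfolding hausdorff1_def using sets.sigma_sets_eq[of "borel :: 'a measure"] by simp

lemma space_hausdorff1 [simp]: "space (hausdorff1 :: 'a::metric_space measure) = UNIV"
  unfolding hausdorff1_def by simp

text \<open>The measure is declared through \<open>measure_of\<close>, which would return the zero measure if the outer measure
were not countably additive on Borel sets.\<close>

lemma emeasure_hausdorff1:
  assumes "A \<in> sets borel"
  shows "emeasure (hausdorff1 :: 'a::metric_space measure) A = hausdorff1_outer A"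
proof (rule emeasure_measure_of[OF hausdorff1_def])
  have "measure_space UNIV (sets borel) (hausdorff1_outer :: 'a set \<Rightarrow> ennreal)"
    by (rule metric_outer_measure_measure_space[OF outer_measure_space_hausdorff1])
       (rule hausdorff1_outer_separated)
  then show "positive (sets hausdorff1) (hausdorff1_outer :: 'a set \<Rightarrow> ennreal)"
    "countably_additive (sets hausdorff1) (hausdorff1_outer :: 'a set \<Rightarrow> ennreal)"
    by (simp_all add: measure_space_def)
qed (use assms in auto)

lemma real_set_subset_interval:
  fixes S :: "real set"
  assumes "\<And>x y. x \<in> S \<Longrightarrow> y \<in> S \<Longrightarrow> x - y \<le> d"
  obtains l where "S \<subseteq> {l..l + d}"
proof (cases "S = {}")
  case True then show ?thesis using that by auto
next
  case False
  then obtain y where y: "y \<in> S" by auto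
  have bdd: "bdd_below S" by (rule bdd_belowI[of _ "y - d"]) (use assms[OF y] in force)
  show ?thesis
  proof (rule that[of "Inf S"], safe)
    fix x assume x: "x \<in> S"
    show "x \<in> {Inf S..Inf S + d}"
      using cInf_lower[OF x bdd] cInf_greatest[OF False, of "x - d"] assms[OF x] by (force simp: algebra_simps)
  qed
qed

text \<open>The images under \<open>T\<close> of the members of a cover of \<open>E\<close> lie in intervals shorter by the factor \<open>K\<close>, and these
intervals cover \<open>S\<close>. In this way a bound for the slope of a graph yields a lower bound for its length.\<close>

lemma hausdorff1_outer_ge_lborel:
  fixes T :: "'a::metric_space \<Rightarrow> real"
  assumes K: "K > 0"
    and T: "\<And>x y. x \<in> E \<Longrightarrow> y \<in> E \<Longrightarrow> K * \<bar>T x - T y\<bar> \<le> dist x y"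
    and S: "S \<in> sets borel" "S \<subseteq> T ` E"
  shows "ennreal K * emeasure lborel S \<le> hausdorff1_outer E"
proof -
  have "ennreal K * emeasure lborel S \<le> hausdorff1_premeasure 1 E"
    unfolding hausdorff1_premeasure_def
  proof (rule INF_greatest, safe)
    fix C :: "nat \<Rightarrow> 'a set"
    assume cov: "E \<subseteq> (\<Union>i. C i)" and C: "\<forall>i. bounded (C i) \<and> diameter (C i) \<le> 1"
    have "\<exists>l. T ` (C i \<inter> E) \<subseteq> {l..l + diameter (C i) / K}" for i
    proof (rule real_set_subset_interval)
      fix x y assume "x \<in> T ` (C i \<inter> E)" "y \<in> T ` (C i \<inter> E)"
      then obtain a b where ab: "a \<in> C i \<inter> E" "b \<in> C i \<inter> E" "x = T a" "y = T b" by auto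
      then have "K * (x - y) \<le> K * \<bar>T a - T b\<bar>" using K by simp
      also have "\<dots> \<le> dist a b" using T ab by auto
      also have "\<dots> \<le> diameter (C i)" using diameter_bounded_bound C ab by auto
      finally show "x - y \<le> diameter (C i) / K" using K by (simp add: field_simps)
    qed auto
    then obtain l where l: "\<And>i. T ` (C i \<inter> E) \<subseteq> {l i..l i + diameter (C i) / K}" by metis
    have "S \<subseteq> (\<Union>i. {l i..l i + diameter (C i) / K})"
    proof
      fix t assume "t \<in> S"
      then obtain x where x: "x \<in> E" "t = T x" using S by auto
      then obtain i where "x \<in> C i" using cov by auto
      with x l[of i] show "t \<in> (\<Union>i. {l i..l i + diameter (C i) / K})" by blast
    qed
    then have "emeasure lborel S \<le> emeasure lborel (\<Union>i. {l i..l i + diameter (C i) / K})"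
      by (intro emeasure_mono) auto
    also have "\<dots> \<le> (\<Sum>i. emeasure lborel {l i..l i + diameter (C i) / K})"
      by (rule emeasure_subadditive_countably) auto
    also have "\<dots> = (\<Sum>i. ennreal (diameter (C i) / K))"
      using K C by (intro suminf_cong) (simp add: diameter_ge_0)
    finally have "ennreal K * emeasure lborel S \<le> ennreal K * (\<Sum>i. ennreal (diameter (C i) / K))"
      by (rule mult_left_mono) simp
    also have "\<dots> = (\<Sum>i. ennreal (diameter (C i)))"
      using K C by (subst ennreal_suminf_cmult[symmetric])
        (simp add: ennreal_mult[symmetric] diameter_ge_0)
    finally show "ennreal K * emeasure lborel S \<le> (\<Sum>i. ennreal (diameter (C i)))" .
  qed
  also have "\<dots> \<le> hausdorff1_outer E" by (rule hausdorff1_premeasure_le_outer) simp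
  finally show ?thesis .
qed

text \<open>By the preceding lemma, the image under \<open>T\<close> of the Hausdorff measure on \<open>E\<close> dominates \<open>K\<close> times Lebesgue
measure on \<open>A\<close>.\<close>

lemma nn_integral_hausdorff1_ge:
  fixes T :: "'a::metric_space \<Rightarrow> real"
  assumes K: "K > 0"
    and T: "\<And>x y. x \<in> E \<Longrightarrow> y \<in> E \<Longrightarrow> K * \<bar>T x - T y\<bar> \<le> dist x y"
    and TM [measurable]: "T \<in> borel_measurable borel"
    and [measurable]: "E \<in> sets borel" "A \<in> sets borel" "f \<in> borel_measurable borel"
    and A: "A \<subseteq> T ` E"
  shows "ennreal K * (\<integral>\<^sup>+t\<in>A. f t \<partial>lborel) \<le> (\<integral>\<^sup>+x\<in>E. f (T x) \<partial>hausdorff1)"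
proof -
  define \<nu> where "\<nu> = distr (density hausdorff1 (indicator E)) borel T"
  have le: "density lborel (\<lambda>t. ennreal K * indicator A t) \<le> \<nu>"
  proof (subst le_measure)
    show "sets (density lborel (\<lambda>t. ennreal K * indicator A t)) = sets \<nu>" by (simp add: \<nu>_def)
    show "\<forall>B\<in>sets (density lborel (\<lambda>t. ennreal K * indicator A t)).
            emeasure (density lborel (\<lambda>t. ennreal K * indicator A t)) B \<le> emeasure \<nu> B"
    proof
      fix B assume "B \<in> sets (density lborel (\<lambda>t. ennreal K * indicator A t))"
      then have B [measurable]: "B \<in> sets borel" by simp
      have [measurable]: "T -` B \<in> sets borel" by (rule measurable_sets_borel[OF TM B])
      have "emeasure (density lborel (\<lambda>t. ennreal K * indicator A t)) B = K * emeasure lborel (A \<inter> B)"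
        by (simp add: emeasure_density nn_integral_cmult mult.assoc flip: indicator_inter_arith)
      also have "\<dots> \<le> hausdorff1_outer (E \<inter> T -` B)"
        by (rule hausdorff1_outer_ge_lborel[where T = T]) (use K T A in auto)
      also have "\<dots> = emeasure hausdorff1 (E \<inter> T -` B)"
        by (rule emeasure_hausdorff1[symmetric]) measurable
      also have "\<dots> = emeasure \<nu> B"
        by (simp add: \<nu>_def emeasure_distr emeasure_density flip: indicator_inter_arith)
      finally show "emeasure (density lborel (\<lambda>t. ennreal K * indicator A t)) B \<le> emeasure \<nu> B" .
    qed
  qed
  have "ennreal K * (\<integral>\<^sup>+t\<in>A. f t \<partial>lborel) = (\<integral>\<^sup>+t. f t \<partial>density lborel (\<lambda>t. ennreal K * indicator A t))"
    by (simp add: nn_integral_density nn_integral_cmult[symmetric] mult_ac)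
  also have "\<dots> \<le> (\<integral>\<^sup>+t. f t \<partial>\<nu>)"
    by (rule nn_integral_mono_measure[OF _ le]) (simp add: \<nu>_def)
  also have "\<dots> = (\<integral>\<^sup>+x\<in>E. f (T x) \<partial>hausdorff1)"
    by (simp add: \<nu>_def nn_integral_distr nn_integral_density mult.commute)
  finally show ?thesis .
qed

lemma hausdorff1_outer_lipschitz_interval:
  fixes \<gamma> :: "real \<Rightarrow> 'a::metric_space"
  assumes L: "L-lipschitz_on {a..b} \<gamma>"
  shows "hausdorff1_outer (\<gamma> ` {a..b}) \<le> ennreal (L * (b - a))"
proof (cases "a \<le> b")
  case False
  then show ?thesis
    using outer_measure_space_hausdorff1[where 'a = 'a] by (auto simp: outer_measure_space_def positive_def)
next
  case True
  have "L \<ge> 0" using L by (rule lipschitz_on_nonneg)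
  show ?thesis
    unfolding hausdorff1_outer_eq
  proof (rule SUP_least)
    fix \<delta> :: real assume "\<delta> \<in> {0<..}"
    then have "\<delta> > 0" by simp
    obtain n :: nat where n: "L * (b - a) / \<delta> < real n" using reals_Archimedean2 by blast
    have "L * (b - a) / \<delta> \<ge> 0" using \<open>L \<ge> 0\<close> True \<open>\<delta> > 0\<close> by simp
    with n have "n > 0" by linarith
    define h where "h = (b - a) / n"
    have "h \<ge> 0" using True by (simp add: h_def)
    have nh: "n * h = b - a" using \<open>n > 0\<close> by (simp add: h_def)
    have Lh: "L * h \<le> \<delta>" using n \<open>n > 0\<close> \<open>\<delta> > 0\<close> by (simp add: h_def field_simps)
    define I where "I i = {a + real i * h..a + (real i + 1) * h} \<inter> {a..b}" for i
    define C where "C i = (if i < n then \<gamma> ` I i else {})" for i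
    have dist: "dist x y \<le> L * h" if xy: "x \<in> C i" "y \<in> C i" for x y i
    proof -
      obtain s t where st: "s \<in> I i" "t \<in> I i" "x = \<gamma> s" "y = \<gamma> t"
        using xy by (cases "i < n") (auto simp: C_def)
      then have "dist x y \<le> L * dist s t" using lipschitz_onD[OF L] by (auto simp: I_def)
      also have "\<dots> \<le> L * h"
        using st \<open>L \<ge> 0\<close> by (intro mult_left_mono) (auto simp: I_def dist_real_def algebra_simps)
      finally show ?thesis .
    qed
    have diam: "diameter (C i) \<le> L * h" for i
      using dist[of _ i] \<open>L \<ge> 0\<close> \<open>h \<ge> 0\<close>
      by (cases "C i = {}") (auto simp: diameter_def intro!: cSUP_least)
    have "hausdorff1_premeasure \<delta> (\<gamma> ` {a..b}) \<le> (\<Sum>i. ennreal (diameter (C i)))"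
    proof (rule hausdorff1_premeasure_le)
      show "\<gamma> ` {a..b} \<subseteq> (\<Union>i. C i)"
      proof
        fix x assume "x \<in> \<gamma> ` {a..b}"
        then obtain t where t: "t \<in> {a..b}" "x = \<gamma> t" by auto
        show "x \<in> (\<Union>i. C i)"
        proof (cases "t = b")
          case True
          have "t \<in> I (n - 1)" using t \<open>n > 0\<close> nh \<open>h \<ge> 0\<close> True
            by (auto simp: I_def of_nat_diff algebra_simps)
          then show ?thesis using t \<open>n > 0\<close> by (intro UN_I[of "n - 1"]) (auto simp: C_def)
        next
          case False
          then have "h > 0" using t \<open>h \<ge> 0\<close> nh by (cases "h = 0") auto
          define i where "i = nat \<lfloor>(t - a) / h\<rfloor>"
          have nonneg: "(t - a) / h \<ge> 0" using t \<open>h > 0\<close> by simp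
          have i: "real i \<le> (t - a) / h" "(t - a) / h < real i + 1"
            using nonneg by (simp_all add: i_def)
          have "real i * h \<le> t - a" "t - a < (real i + 1) * h"
            using i \<open>h > 0\<close> by (simp_all add: field_simps)
          moreover have "real i < n"
          proof -
            have "(t - a) / h < n" using t False nh \<open>h > 0\<close> by (simp add: field_simps)
            with i show ?thesis by linarith
          qed
          ultimately show ?thesis using t by (intro UN_I[of i]) (auto simp: C_def I_def)
        qed
      qed
      show "bounded (C i)" for i
        unfolding bounded_def using dist[of _ i] by (cases "C i = {}") blast+
      show "diameter (C i) \<le> \<delta>" for i using diam[of i] Lh by simp
    qed
    also have "\<dots> = (\<Sum>i<n. ennreal (diameter (C i)))"
      by (rule suminf_finite) (auto simp: C_def)
    also have "\<dots> \<le> (\<Sum>i<n. ennreal (L * h))"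
      by (intro sum_mono ennreal_leI diam)
    also have "\<dots> = ennreal (n * (L * h))"
      using \<open>L \<ge> 0\<close> \<open>h \<ge> 0\<close> by (simp add: ennreal_mult ennreal_of_nat_eq_real_of_nat)
    also have "n * (L * h) = L * (b - a)" by (simp add: nh[symmetric])
    finally show "hausdorff1_premeasure \<delta> (\<gamma> ` {a..b}) \<le> ennreal (L * (b - a))" .
  qed
qed

section \<open>Smooth functions as competitors\<close>

lemma partial_deriv_eqI:
  assumes "(f has_derivative f') (at x)"
  shows "partial_deriv i f x = f' (axis i 1)"
  using frechet_derivative_at[OF assms] by (simp add: partial_deriv_def)

lemma has_derivative_exp_component:
  "((\<lambda>x::real^'n. c * exp (k * x $ j)) has_derivative (\<lambda>h. c * k * exp (k * x $ j) * h $ j)) (at x)"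
  by (auto intro!: derivative_eq_intros bounded_linear_imp_has_derivative[OF bounded_linear_vec_nth]
      simp: mult_ac)

lemma partial_deriv_exp_component:
  "partial_deriv i (\<lambda>x::real^'n. c * exp (k * x $ j)) x = (if i = j then c * k * exp (k * x $ j) else 0)"
  by (subst partial_deriv_eqI[OF has_derivative_exp_component]) (auto simp: axis_def)

lemma smooth_exp_component: "smooth (\<lambda>x::real^'n. exp (k * x $ j))"
proof -
  have "Ck m (\<lambda>x::real^'n. c * exp (k * x $ j))" for m c
  proof (induction m arbitrary: c)
    case 0 show ?case by (auto intro!: continuous_intros)
  next
    case (Suc m)
    have "Ck m (partial_deriv i (\<lambda>x::real^'n. c * exp (k * x $ j)))" for i
      using Suc[of "c * k"] Suc[of 0] by (cases "i = j") (simp_all add: partial_deriv_exp_component[abs_def])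
    then show ?case
      using has_derivative_exp_component[of c k j] by (simp add: differentiable_def) blast
  qed
  from this[where c = 1] show ?thesis by (simp add: smooth_def)
qed

lemma grad_exp_component:
  "grad (\<lambda>x::real^'n. exp (k * x $ j)) x = axis j (k * exp (k * x $ j))"
  using partial_deriv_exp_component[of _ 1 k j x] by (simp add: grad_def vec_eq_iff axis_def)

text \<open>The integral of a difference quotient of \<open>f\<close> vanishes by translation invariance, and the difference
quotients converge boundedly to the partial derivative on a common compact set.\<close>

lemma integral_partial_deriv_compact_support:
  fixes f :: "real^'n \<Rightarrow> real"
  assumes diff: "\<And>x. f differentiable (at x)"
    and cont: "continuous_on UNIV (partial_deriv i f)"
    and K: "compact K" "\<And>x. x \<notin> K \<Longrightarrow> f x = 0"
  shows "(\<integral>x. partial_deriv i f x \<partial>lborel) = 0"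
proof -
  define e :: "real^'n" where "e = axis i 1"
  have norm_e: "norm e = 1" by (simp add: e_def)
  have fcont: "continuous_on UNIV f"
    using diff differentiable_imp_continuous_on by (auto simp: differentiable_on_def)
  have [measurable]: "f \<in> borel_measurable borel" "partial_deriv i f \<in> borel_measurable borel"
    using fcont cont by (auto intro: borel_measurable_continuous_onI)
  have line: "((\<lambda>t. f (x + t *\<^sub>R e)) has_real_derivative partial_deriv i f (x + t *\<^sub>R e)) (at t)" for x t
  proof -
    have 1: "(f has_derivative frechet_derivative f (at (x + t *\<^sub>R e))) (at (x + t *\<^sub>R e))"
      using diff frechet_derivative_works by blast
    have 2: "((\<lambda>t. x + t *\<^sub>R e) has_derivative (\<lambda>h. h *\<^sub>R e)) (at t)"
      by (auto intro!: derivative_eq_intros)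
    have "((\<lambda>t. f (x + t *\<^sub>R e)) has_derivative (\<lambda>h. frechet_derivative f (at (x + t *\<^sub>R e)) (h *\<^sub>R e))) (at t)"
      using has_derivative_compose[OF 2 1] by simp
    moreover have "frechet_derivative f (at (x + t *\<^sub>R e)) (h *\<^sub>R e) = partial_deriv i f (x + t *\<^sub>R e) * h" for h
      using linear_frechet_derivative[OF diff, of "x + t *\<^sub>R e"]
      by (simp add: linear_scale partial_deriv_def e_def)
    ultimately show ?thesis by (simp add: has_field_derivative_def)
  qed
  \<comment> \<open>outside \<open>K'\<close> both \<open>f x\<close> and \<open>f (x + t e)\<close>, \<open>0 \<le> t \<le> 1\<close>, vanish\<close>
  define K' where "K' = (\<lambda>(x, t). x - t *\<^sub>R e) ` (K \<times> {0..1::real})"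
  have K': "compact K'" unfolding K'_def
    by (intro compact_continuous_image compact_Times K) (auto intro!: continuous_intros simp: split_def)
  have "compact (partial_deriv i f ` (\<lambda>(x, t). x + t *\<^sub>R e) ` (K' \<times> {0..1::real}))"
    by (intro compact_continuous_image compact_Times K' continuous_on_subset[OF cont])
       (auto intro!: continuous_intros simp: split_def)
  then obtain M where M: "\<And>x t. x \<in> K' \<Longrightarrow> t \<in> {0..1} \<Longrightarrow> \<bar>partial_deriv i f (x + t *\<^sub>R e)\<bar> \<le> M"
    unfolding bounded_iff[of "partial_deriv i f ` _", symmetric]
    by (force dest!: compact_imp_bounded simp: bounded_iff)
  define d where "d m x = real (Suc m) * (f (x + inverse (real (Suc m)) *\<^sub>R e) - f x)" for m x
  have [measurable]: "d m \<in> borel_measurable borel" for m unfolding d_def by measurable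
  have K'_meas [measurable]: "K' \<in> sets borel" using K' by (rule borel_compact)
  have bound: "\<bar>d m x\<bar> \<le> M * indicator K' x" for m x
  proof (cases "x \<in> K'")
    case True
    define h where "h = inverse (real (Suc m))"
    have h: "0 < h" "h \<le> 1" "real (Suc m) * h = 1" by (auto simp: h_def divide_simps)
    obtain z where z: "0 < z" "z < h" "f (x + h *\<^sub>R e) - f (x + 0 *\<^sub>R e) = (h - 0) * partial_deriv i f (x + z *\<^sub>R e)"
      using MVT2[OF h(1), of "\<lambda>t. f (x + t *\<^sub>R e)" "\<lambda>t. partial_deriv i f (x + t *\<^sub>R e)"] line by blast
    then have "d m x = real (Suc m) * (h * partial_deriv i f (x + z *\<^sub>R e))"
      unfolding d_def h_def[symmetric] by (simp only: scaleR_zero_left add_0_right diff_0_right)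
    then have "d m x = (real (Suc m) * h) * partial_deriv i f (x + z *\<^sub>R e)"
      by (simp only: mult.assoc)
    then have "d m x = partial_deriv i f (x + z *\<^sub>R e)" by (simp only: h mult_1)
    then show ?thesis using M[OF True, of z] z h True by auto
  next
    case False
    have "x + t *\<^sub>R e \<notin> K" if "t \<in> {0..1}" for t
    proof
      assume "x + t *\<^sub>R e \<in> K"
      then have "(\<lambda>(x, t). x - t *\<^sub>R e) (x + t *\<^sub>R e, t) \<in> K'" unfolding K'_def using that by blast
      with False show False by simp
    qed
    from this[of 0] this[of "inverse (real (Suc m))"] show ?thesis
      using K(2) False by (simp add: d_def inverse_le_1_iff)
  qed
  have K'_int: "integrable lborel (\<lambda>x. M * indicator K' x)"
    using emeasure_compact_finite[OF K'] by (intro integrable_mult_right integrable_real_indicator) auto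
  have f_int: "integrable lborel f"
  proof -
    obtain B where B: "\<And>x. x \<in> K \<Longrightarrow> norm (f x) \<le> B"
      using compact_imp_bounded[OF compact_continuous_image[OF continuous_on_subset[OF fcont] K(1)]]
      by (force simp: bounded_iff)
    show ?thesis
    proof (rule Bochner_Integration.integrable_bound)
      show "integrable lborel (\<lambda>x. B * indicator K x)"
        using emeasure_compact_finite[OF K(1)] borel_compact[OF K(1)]
        by (intro integrable_mult_right integrable_real_indicator) auto
      have "norm (f x) \<le> norm (B * indicator K x)" for x
        using B[of x] K(2)[of x] by (cases "x \<in> K") auto
      then show "AE x in lborel. norm (f x) \<le> norm (B * indicator K x)" by simp
    qed simp
  qed
  have shift: "integrable lborel (\<lambda>x. f (x + c)) \<and> (\<integral>x. f (x + c) \<partial>lborel) = (\<integral>x. f x \<partial>lborel)" for c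
  proof -
    have "integrable (distr lborel borel ((+) c)) f" by (simp add: lborel_distr_plus f_int)
    then have "integrable lborel (\<lambda>x. f (c + x))" by (subst (asm) integrable_distr_eq) auto
    moreover have "(\<integral>x. f (c + x) \<partial>lborel) = (\<integral>x. f x \<partial>distr lborel borel ((+) c))"
      by (subst integral_distr) auto
    ultimately show ?thesis by (simp add: lborel_distr_plus add.commute)
  qed
  have d_int: "(\<integral>x. d m x \<partial>lborel) = 0" for m
    unfolding d_def by (simp add: shift f_int)
  have "(\<lambda>m. \<integral>x. d m x \<partial>lborel) \<longlonglongrightarrow> (\<integral>x. partial_deriv i f x \<partial>lborel)"
  proof (rule integral_dominated_convergence[OF _ _ K'_int])
    have "(\<lambda>m. d m x) \<longlonglongrightarrow> partial_deriv i f x" for x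
    proof -
      have "((\<lambda>h. (f (x + h *\<^sub>R e) - f x) / h) \<longlongrightarrow> partial_deriv i f x) (at 0)"
        using line[of x 0] by (simp add: DERIV_def)
      moreover have "filterlim (\<lambda>m. inverse (real (Suc m))) (at 0) sequentially"
        unfolding filterlim_at using LIMSEQ_inverse_real_of_nat by auto
      ultimately have "(\<lambda>m. (f (x + inverse (real (Suc m)) *\<^sub>R e) - f x) / inverse (real (Suc m))) \<longlonglongrightarrow> partial_deriv i f x"
        by (rule filterlim_compose)
      then show ?thesis by (simp add: d_def divide_inverse mult.commute)
    qed
    then show "AE x in lborel. (\<lambda>m. d m x) \<longlonglongrightarrow> partial_deriv i f x" by simp
    show "AE x in lborel. norm (d m x) \<le> M * indicator K' x" for m using bound by simp
  qed auto
  then show ?thesis by (simp add: d_int LIMSEQ_const_iff)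
qed

lemma test_functionD:
  assumes "test_function \<Omega> \<psi>"
  shows "\<psi> differentiable (at x)" "continuous_on UNIV \<psi>" "continuous_on UNIV (partial_deriv i \<psi>)"
proof -
  have Ck: "Ck k \<psi>" for k using assms by (auto simp: test_function_def smooth_def)
  show "\<psi> differentiable (at x)" using Ck[of 1] by simp
  show "continuous_on UNIV \<psi>" using Ck[of 0] by simp
  show "continuous_on UNIV (partial_deriv i \<psi>)" using Ck[of 1] by simp
qed

text \<open>Integration by parts: apply the preceding lemma to the product of \<open>u\<close> and the test function.\<close>

lemma weak_gradient_grad:
  fixes u :: "real^'n \<Rightarrow> real"
  assumes "open \<Omega>" and diff: "\<And>x. u differentiable (at x)"
    and cont: "\<And>i. continuous_on UNIV (partial_deriv i u)"
  shows "weak_gradient \<Omega> u (grad u)"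
  unfolding weak_gradient_def
proof (intro allI impI)
  fix \<psi> i assume \<psi>: "test_function \<Omega> \<psi>"
  define K where "K = closure {x. \<psi> x \<noteq> 0}"
  have K: "compact K" "K \<subseteq> \<Omega>" using \<psi> by (auto simp: K_def test_function_def)
  have out: "\<psi> x = 0" if "x \<notin> K" for x
    using that closure_subset[of "{x. \<psi> x \<noteq> 0}"] by (auto simp: K_def)
  have out': "partial_deriv i \<psi> x = 0" if "x \<notin> K" for x
  proof -
    have "(\<psi> has_derivative (\<lambda>_. 0)) (at x)"
    proof (rule has_derivative_transform_within_open)
      show "((\<lambda>_. 0) has_derivative (\<lambda>_. 0)) (at x)" by simp
      show "open (- K)" using K by (simp add: compact_imp_closed open_Compl)
    qed (use that out in auto)
    then show ?thesis by (simp add: partial_deriv_eqI)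
  qed
  have ucont: "continuous_on UNIV u"
    using diff differentiable_imp_continuous_on by (auto simp: differentiable_on_def)
  have prod: "partial_deriv i (\<lambda>x. u x * \<psi> x) x = u x * partial_deriv i \<psi> x + partial_deriv i u x * \<psi> x" for x
  proof -
    have "(u has_derivative frechet_derivative u (at x)) (at x)"
      "(\<psi> has_derivative frechet_derivative \<psi> (at x)) (at x)"
      using diff test_functionD(1)[OF \<psi>] frechet_derivative_works by blast+
    from has_derivative_mult[OF this] show ?thesis
      by (subst partial_deriv_eqI) (auto simp: partial_deriv_def)
  qed
  have int: "integrable lborel g" if "continuous_on UNIV g" "\<And>x. x \<notin> K \<Longrightarrow> g x = 0" for g :: "real^'n \<Rightarrow> real"
  proof -
    have "integrable lborel (\<lambda>x. indicator K x *\<^sub>R g x)"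
      by (rule borel_integrable_compact[OF K(1)]) (use that continuous_on_subset in blast)
    also have "(\<lambda>x. indicator K x *\<^sub>R g x) = g"
      using that(2) by (auto simp: indicator_def fun_eq_iff)
    finally show ?thesis .
  qed
  have restrict: "(\<integral>x. g x \<partial>lebesgue_on \<Omega>) = (\<integral>x. g x \<partial>lborel)"
    if "continuous_on UNIV g" "\<And>x. x \<notin> K \<Longrightarrow> g x = 0" for g :: "real^'n \<Rightarrow> real"
  proof -
    have "(\<integral>x. g x \<partial>lebesgue_on \<Omega>) = (\<integral>x. indicator \<Omega> x *\<^sub>R g x \<partial>lebesgue)"
      using \<open>open \<Omega>\<close> by (intro integral_restrict_space) auto
    also have "(\<lambda>x. indicator \<Omega> x *\<^sub>R g x) = g"
      using that(2) K(2) by (auto simp: indicator_def fun_eq_iff)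
    also have "(\<integral>x. g x \<partial>lebesgue) = (\<integral>x. g x \<partial>lborel)"
      using that(1) by (intro integral_completion) (simp add: borel_measurable_continuous_onI)
    finally show ?thesis .
  qed
  have cont1: "continuous_on UNIV (\<lambda>x. u x * partial_deriv i \<psi> x)"
    "continuous_on UNIV (\<lambda>x. partial_deriv i u x * \<psi> x)"
    by (intro continuous_intros ucont cont test_functionD[OF \<psi>])+
  have "0 = (\<integral>x. partial_deriv i (\<lambda>x. u x * \<psi> x) x \<partial>lborel)"
  proof (rule integral_partial_deriv_compact_support[symmetric, OF _ _ K(1)])
    show "(\<lambda>x. u x * \<psi> x) differentiable (at x)" for x
      by (intro differentiable_mult diff test_functionD[OF \<psi>])
    show "continuous_on UNIV (partial_deriv i (\<lambda>x. u x * \<psi> x))"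
      unfolding prod[abs_def] by (intro continuous_intros cont1)
  qed (simp add: out)
  also have "\<dots> = (\<integral>x. u x * partial_deriv i \<psi> x \<partial>lborel) + (\<integral>x. partial_deriv i u x * \<psi> x \<partial>lborel)"
    unfolding prod by (intro Bochner_Integration.integral_add int cont1) (auto simp: out out')
  also have "(\<integral>x. u x * partial_deriv i \<psi> x \<partial>lborel) = (\<integral>x. u x * partial_deriv i \<psi> x \<partial>lebesgue_on \<Omega>)"
    by (rule restrict[symmetric, OF cont1(1)]) (simp add: out')
  also have "(\<integral>x. partial_deriv i u x * \<psi> x \<partial>lborel) = (\<integral>x. partial_deriv i u x * \<psi> x \<partial>lebesgue_on \<Omega>)"
    by (rule restrict[symmetric, OF cont1(2)]) (simp add: out)
  finally show "(\<integral>x. u x * partial_deriv i \<psi> x \<partial>lebesgue_on \<Omega>)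
      = - (\<integral>x. grad u x $ i * \<psi> x \<partial>lebesgue_on \<Omega>)"
    by (simp add: grad_def)
qed

lemma Lp_lebesgue_on_continuous:
  fixes f :: "real ^ 'n \<Rightarrow> 'b::real_normed_vector"
  assumes "p > 0" "open \<Omega>" "bounded \<Omega>" and f: "continuous_on UNIV f"
  shows "f \<in> Lp p (lebesgue_on \<Omega>)"
proof -
  have g: "continuous_on UNIV (\<lambda>x. norm (f x) powr p)"
    using \<open>p > 0\<close> f by (intro continuous_on_powr' continuous_intros) auto
  have meas: "h \<in> borel_measurable (lebesgue_on \<Omega>)" if "continuous_on UNIV h" for h :: "real ^ 'n \<Rightarrow> 'c::real_normed_vector"
    using that by (intro measurable_restrict_space1 measurable_completion) (simp add: borel_measurable_continuous_onI)
  have "compact (closure \<Omega>)" using \<open>bounded \<Omega>\<close> by simp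
  then have "bounded ((\<lambda>x. norm (f x) powr p) ` (closure \<Omega>))"
    by (intro compact_imp_bounded compact_continuous_image continuous_on_subset[OF g]) auto
  then obtain B where B: "\<And>x. x \<in> closure \<Omega> \<Longrightarrow> norm (norm (f x) powr p) \<le> B"
    by (auto simp: bounded_iff)
  have "integrable (lebesgue_on \<Omega>) (\<lambda>x. norm (f x) powr p)"
  proof (rule integrableI_bounded_set[where A = \<Omega> and B = B])
    show "emeasure (lebesgue_on \<Omega>) \<Omega> < \<infinity>"
      using emeasure_bounded_finite[OF \<open>bounded \<Omega>\<close>] \<open>open \<Omega>\<close> by (simp add: emeasure_restrict_space)
    show "AE x in lebesgue_on \<Omega>. x \<in> \<Omega> \<longrightarrow> norm (norm (f x) powr p) \<le> B"
      using B closure_subset by blast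
    show "AE x in lebesgue_on \<Omega>. x \<notin> \<Omega> \<longrightarrow> norm (f x) powr p = 0"
      using \<open>open \<Omega>\<close> by (simp add: AE_restrict_space_iff)
  qed (use \<open>open \<Omega>\<close> meas[OF g] in auto)
  then show ?thesis using meas[OF f] by (simp add: Lp_def)
qed

lemma Lp_boundary_measure_continuous:
  fixes f :: "real ^ 2 \<Rightarrow> real"
  assumes "p > 0" "bounded \<Omega>" and fin: "emeasure hausdorff1 (frontier \<Omega>) < \<infinity>" and f: "continuous_on UNIV f"
  shows "f \<in> Lp p (boundary_measure \<Omega>)"
proof -
  have fr [measurable]: "frontier \<Omega> \<in> sets borel" by simp
  have g: "continuous_on UNIV (\<lambda>x. norm (f x) powr p)"
    using \<open>p > 0\<close> f by (intro continuous_on_powr' continuous_intros) auto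
  have meas: "h \<in> borel_measurable (boundary_measure \<Omega>)" if "continuous_on UNIV h" for h :: "real ^ 2 \<Rightarrow> real"
    using that unfolding boundary_measure_def
    by (intro measurable_restrict_space1) (simp add: borel_measurable_continuous_onI measurable_cong_sets[OF sets_hausdorff1 refl])
  have "compact (frontier \<Omega>)" using \<open>bounded \<Omega>\<close> by (simp add: compact_frontier_bounded)
  then have "bounded ((\<lambda>x. norm (f x) powr p) ` (frontier \<Omega>))"
    by (intro compact_imp_bounded compact_continuous_image continuous_on_subset[OF g]) auto
  then obtain B where B: "\<And>x. x \<in> frontier \<Omega> \<Longrightarrow> norm (norm (f x) powr p) \<le> B"
    by (auto simp: bounded_iff)
  have "integrable (boundary_measure \<Omega>) (\<lambda>x. norm (f x) powr p)"
  proof (rule integrableI_bounded_set[where A = "frontier \<Omega>" and B = B])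
    show "emeasure (boundary_measure \<Omega>) (frontier \<Omega>) < \<infinity>"
      using fin by (simp add: boundary_measure_def emeasure_restrict_space)
    show "AE x in boundary_measure \<Omega>. x \<in> frontier \<Omega> \<longrightarrow> norm (norm (f x) powr p) \<le> B"
      using B by blast
    show "AE x in boundary_measure \<Omega>. x \<notin> frontier \<Omega> \<longrightarrow> norm (f x) powr p = 0"
      by (rule AE_I2) (simp add: boundary_measure_def space_restrict_space)
    show "frontier \<Omega> \<in> sets (boundary_measure \<Omega>)"
      by (simp add: boundary_measure_def sets_restrict_space_iff)
  qed (rule meas[OF g])
  then show ?thesis using meas[OF f] by (simp add: Lp_def)
qed

lemma not_AE_False_lebesgue_on_open:
  assumes "open \<Omega>" "\<Omega> \<noteq> {}"
  shows "\<not> (AE x in lebesgue_on \<Omega>. False)"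
proof
  assume "AE x in lebesgue_on \<Omega>. False"
  then have "AE x\<in>\<Omega> in lebesgue. x \<in> {}"
    using \<open>open \<Omega>\<close> by (simp add: AE_restrict_space_iff)
  then show False
    using mem_closed_if_AE_lebesgue_open[OF \<open>open \<Omega>\<close>, of "{}"] \<open>\<Omega> \<noteq> {}\<close> by auto
qed

text \<open>A smooth function is its own trace, as the constant sequence \<open>u, u, \<dots>\<close> approximates it. Finite length
of the boundary puts the restriction into \<open>L\<^sup>p\<close>.\<close>

lemma robin_Lambda_le_quotient:
  fixes u :: "real ^ 2 \<Rightarrow> real"
  assumes p: "p > 0" and \<Omega>: "open \<Omega>" "bounded \<Omega>" and fin: "emeasure hausdorff1 (frontier \<Omega>) < \<infinity>"
    and u: "smooth u" and nz: "\<not> (AE x in lebesgue_on \<Omega>. u x = 0)"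
  shows "robin_Lambda p \<Omega> \<alpha> \<le> ereal (robin_quotient p \<Omega> \<alpha> u (grad u) u)"
proof -
  have "Ck 0 u" "Ck 1 u" using u by (auto simp: smooth_def)
  then have diff: "u differentiable (at x)" and cont: "continuous_on UNIV u"
    and pd: "continuous_on UNIV (partial_deriv i u)" for x i
    by auto
  have grad: "continuous_on UNIV (grad u)"
  proof -
    have "continuous_on UNIV (\<lambda>x. \<chi> i. partial_deriv i u x)"
      by (rule continuous_on_vec_lambda) (rule pd)
    then show ?thesis by (simp add: grad_def[abs_def])
  qed
  have W: "W1p_gradient p \<Omega> u (grad u)"
    unfolding W1p_gradient_def
    by (intro conjI Lp_lebesgue_on_continuous[OF p \<Omega>] weak_gradient_grad[OF \<Omega>(1) diff pd] cont grad)
  have [simp]: "Lp_tendsto p M (\<lambda>_. f) f" for M :: "'a measure" and f :: "'a \<Rightarrow> 'b::real_normed_vector"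
    using p by (simp add: Lp_tendsto_def)
  have "boundary_trace p \<Omega> u u"
    unfolding boundary_trace_def
    using Lp_boundary_measure_continuous[OF p \<Omega>(2) fin cont] W u
    by (intro conjI exI[of _ "grad u"] exI[of _ "\<lambda>_. u"]) simp_all
  then show ?thesis
    unfolding robin_Lambda_def using W nz by (intro Inf_lower) (auto simp: W1p_def)
qed

section \<open>Superdiscs\<close>

definition superdisc_gauge :: "real \<Rightarrow> real ^ 2 \<Rightarrow> real" where
  "superdisc_gauge s x = \<bar>x $ 1\<bar> powr s + \<bar>x $ 2\<bar> powr s"

definition superdisc :: "real \<Rightarrow> (real ^ 2) set" where
  "superdisc s = {x. superdisc_gauge s x < 1}"

definition superdisc_profile :: "real \<Rightarrow> real \<Rightarrow> real" where
  "superdisc_profile s t = (1 - \<bar>t\<bar> powr s) powr (1 / s)"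

text \<open>This is minus the derivative of the profile. The numerator is \<open>sgn t\<close> times \<open>\<bar>t\<bar> powr (s - 1)\<close>,
in a form whose continuity at \<open>0\<close> is immediate.\<close>

definition superdisc_slope :: "real \<Rightarrow> real \<Rightarrow> real" where
  "superdisc_slope s t =
     (max t 0 powr (s - 1) - max (- t) 0 powr (s - 1)) / superdisc_profile s t powr (s - 1)"

lemma abs_powr_less_one: "s > 0 \<Longrightarrow> \<bar>t\<bar> powr s < 1 \<longleftrightarrow> \<bar>t :: real\<bar> < 1"
  using powr_less_mono2[of s "\<bar>t\<bar>" 1] powr_mono2[of s 1 "\<bar>t\<bar>"] by force

lemma continuous_on_superdisc_gauge: "s > 0 \<Longrightarrow> continuous_on UNIV (superdisc_gauge s)"
  unfolding superdisc_gauge_def by (intro continuous_intros continuous_on_powr') auto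

lemma superdisc_gauge_scale: "superdisc_gauge s (c *\<^sub>R x) = \<bar>c\<bar> powr s * superdisc_gauge s x"
  by (simp add: superdisc_gauge_def abs_mult powr_mult algebra_simps)

lemma superdisc_gauge_nonneg: "superdisc_gauge s x \<ge> 0"
  by (simp add: superdisc_gauge_def)

lemma open_superdisc: "s > 0 \<Longrightarrow> open (superdisc s)"
  unfolding superdisc_def using continuous_on_superdisc_gauge open_Collect_less[of "superdisc_gauge s" "\<lambda>_. 1"] by simp

lemma connected_superdisc:
  assumes "s > 0" shows "connected (superdisc s)"
proof (rule starlike_imp_connected)
  have "c *\<^sub>R x \<in> superdisc s" if "x \<in> superdisc s" "0 \<le> c" "c \<le> 1" for c x
  proof -
    have "c powr s * superdisc_gauge s x \<le> 1 * superdisc_gauge s x"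
      using that assms powr_mono2[of s c 1] by (intro mult_right_mono superdisc_gauge_nonneg) auto
    then show ?thesis using that by (simp add: superdisc_def superdisc_gauge_scale)
  qed
  then show "starlike (superdisc s)"
    unfolding starlike_def
    by (intro bexI[of _ 0]) (auto simp: closed_segment_def superdisc_def superdisc_gauge_def)
qed

lemma superdisc_component_bound:
  assumes "s > 0" "superdisc_gauge s x \<le> 1" shows "\<bar>x $ i\<bar> \<le> 1"
proof -
  have "\<bar>x $ i\<bar> powr s \<le> 1"
    using assms(2) exhaust_2[of i] by (auto simp: superdisc_gauge_def) (smt (verit) powr_ge_zero)+
  moreover have "1 powr s < \<bar>x $ i\<bar> powr s" if "1 < \<bar>x $ i\<bar>"
    by (rule powr_less_mono2) (use assms(1) that in auto)
  ultimately show ?thesis by fastforce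
qed

lemma bounded_superdisc: "s > 0 \<Longrightarrow> bounded (superdisc s)"
proof (rule boundedI)
  fix x assume "s > 0" "x \<in> superdisc s"
  then have "\<bar>x $ i\<bar> \<le> 1" for i by (intro superdisc_component_bound) (auto simp: superdisc_def)
  then show "norm x \<le> 2"
    using norm_le_l1_cart[of x] order_trans[of "norm x" "\<bar>x $ 1\<bar> + \<bar>x $ 2\<bar>" 2] add_mono[of "\<bar>x $ 1\<bar>" 1 "\<bar>x $ 2\<bar>" 1]
    by (simp add: sum_2)
qed

lemma frontier_superdisc:
  assumes "s > 0" shows "frontier (superdisc s) = {x. superdisc_gauge s x = 1}"
proof
  have "closed {x. superdisc_gauge s x \<le> 1}"
    using continuous_on_superdisc_gauge[OF assms] closed_Collect_le[of "superdisc_gauge s" "\<lambda>_. 1"] by simp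
  then have "closure (superdisc s) \<subseteq> {x. superdisc_gauge s x \<le> 1}"
    by (intro closure_minimal) (auto simp: superdisc_def)
  then show "frontier (superdisc s) \<subseteq> {x. superdisc_gauge s x = 1}"
    using open_superdisc[OF assms] by (auto simp: frontier_def interior_open superdisc_def)
  show "{x. superdisc_gauge s x = 1} \<subseteq> frontier (superdisc s)"
  proof safe
    fix x assume x: "superdisc_gauge s x = 1"
    have "(\<lambda>n. (1 - inverse (real (Suc n))) *\<^sub>R x) \<longlonglongrightarrow> (1 - 0) *\<^sub>R x"
      by (intro tendsto_intros LIMSEQ_inverse_real_of_nat)
    moreover have "(1 - inverse (real (Suc n))) *\<^sub>R x \<in> superdisc s" for n
      using powr_less_mono2[OF assms, of "1 - inverse (real (Suc n))" 1] x
      by (simp add: superdisc_def superdisc_gauge_scale divide_simps)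
    ultimately have "x \<in> closure (superdisc s)"
      unfolding closure_sequential by (intro exI[of _ "\<lambda>n. (1 - inverse (real (Suc n))) *\<^sub>R x"]) simp
    then show "x \<in> frontier (superdisc s)"
      using open_superdisc[OF assms] x by (simp add: frontier_def interior_open superdisc_def)
  qed
qed

context
  fixes s :: real
  assumes s: "s > 1"
begin

lemma superdisc_profile_powr: "\<bar>t\<bar> < 1 \<Longrightarrow> superdisc_profile s t powr s = 1 - \<bar>t\<bar> powr s"
  using s abs_powr_less_one[of s t] by (simp add: superdisc_profile_def powr_powr)

lemma superdisc_profile_pos: "\<bar>t\<bar> < 1 \<Longrightarrow> superdisc_profile s t > 0"
  using s abs_powr_less_one[of s t] by (simp add: superdisc_profile_def)

lemma superdisc_profile_le_one: "\<bar>t\<bar> < 1 \<Longrightarrow> superdisc_profile s t \<le> 1"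
  using s abs_powr_less_one[of s t] powr_mono2[of "1/s" "1 - \<bar>t\<bar> powr s" 1]
  by (simp add: superdisc_profile_def)

lemma superdisc_profile_ge: "\<bar>t\<bar> < 1 \<Longrightarrow> 1 - \<bar>t\<bar> powr s \<le> superdisc_profile s t"
  using s abs_powr_less_one[of s t] powr_mono'[of "1/s" 1 "1 - \<bar>t\<bar> powr s"]
  by (simp add: superdisc_profile_def)

text \<open>Bernoulli's inequality \<open>1 - y\<^sup>s \<le> s (1 - y)\<close> for \<open>0 < y \<le> 1\<close>, at the height \<open>y\<close> of the profile.\<close>

lemma superdisc_profile_le:
  assumes "\<bar>t\<bar> < 1" shows "superdisc_profile s t \<le> 1 - \<bar>t\<bar> powr s / s"
proof -
  define y where "y = superdisc_profile s t"
  have y: "0 < y" "y \<le> 1" "y powr s = 1 - \<bar>t\<bar> powr s"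
    using superdisc_profile_pos superdisc_profile_le_one superdisc_profile_powr assms
    by (auto simp: y_def)
  have "1 - y powr s \<le> s * (1 - y)"
  proof (cases "y = 1")
    case False
    then have "y < 1" using y by simp
    have "((\<lambda>z. z powr s) has_real_derivative s * z powr (s - 1)) (at z)" if "y \<le> z" for z
      using that y by (auto intro!: derivative_eq_intros simp: powr_diff)
    with MVT2[OF \<open>y < 1\<close>, of "\<lambda>z. z powr s" "\<lambda>z. s * z powr (s - 1)"]
    obtain z where z: "y < z" "z < 1" "1 powr s - y powr s = (1 - y) * (s * z powr (s - 1))"
      by blast
    have "z powr (s - 1) \<le> 1" using z y s powr_mono2[of "s - 1" z 1] by simp
    then have "(1 - y) * (s * z powr (s - 1)) \<le> (1 - y) * (s * 1)"
      using s y by (intro mult_left_mono) auto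
    with z show ?thesis by (simp add: mult.commute)
  qed simp
  then show ?thesis using y s by (simp add: y_def field_simps)
qed

lemma superdisc_graph:
  assumes "\<bar>x $ 1\<bar> < 1" "x $ 2 > 0"
  shows "superdisc_gauge s x < 1 \<longleftrightarrow> x $ 2 < superdisc_profile s (x $ 1)"
    and "superdisc_gauge s x = 1 \<longleftrightarrow> x $ 2 = superdisc_profile s (x $ 1)"
proof -
  note p = superdisc_profile_powr[OF assms(1)] superdisc_profile_pos[OF assms(1)]
  show "superdisc_gauge s x < 1 \<longleftrightarrow> x $ 2 < superdisc_profile s (x $ 1)"
    and "superdisc_gauge s x = 1 \<longleftrightarrow> x $ 2 = superdisc_profile s (x $ 1)"
    using s assms p powr_less_mono2[of s "x $ 2" "superdisc_profile s (x $ 1)"]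
      powr_less_mono2[of s "superdisc_profile s (x $ 1)" "x $ 2"]
    by (cases "x $ 2" "superdisc_profile s (x $ 1)" rule: linorder_cases;
        force simp: superdisc_gauge_def)+
qed

lemma has_derivative_abs_powr:
  "((\<lambda>t. \<bar>t\<bar> powr s) has_real_derivative s * (max t 0 powr (s - 1) - max (- t) 0 powr (s - 1))) (at t)"
proof (cases t "0 :: real" rule: linorder_cases)
  case equal
  have "((\<lambda>h. \<bar>h\<bar> powr (s - 1)) \<longlongrightarrow> \<bar>0\<bar> powr (s - 1)) (at (0::real))"
    using s by (intro tendsto_powr' tendsto_intros) auto
  then have "((\<lambda>h. \<bar>\<bar>h\<bar> powr s / h\<bar>) \<longlongrightarrow> 0) (at (0::real))"
    using s by (rule_tac Lim_transform_within[where d = 1]) (auto simp: powr_diff abs_divide)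
  then have "((\<lambda>h. \<bar>h\<bar> powr s / h) \<longlongrightarrow> 0) (at (0::real))"
    by (rule tendsto_rabs_zero_cancel)
  then show ?thesis using s equal by (simp add: DERIV_def)
next
  case greater
  have "((\<lambda>t. t powr s) has_real_derivative s * (max t 0 powr (s - 1) - max (- t) 0 powr (s - 1))) (at t)"
    using greater s by (auto intro!: derivative_eq_intros simp: powr_diff)
  then show ?thesis
    by (rule has_field_derivative_transform_within_open[where S = "{0<..}"]) (use greater in auto)
next
  case less
  have "((\<lambda>t. (-t) powr s) has_real_derivative s * (max t 0 powr (s - 1) - max (- t) 0 powr (s - 1))) (at t)"
    using less s by (auto intro!: derivative_eq_intros simp: powr_diff)
  then show ?thesis
    by (rule has_field_derivative_transform_within_open[where S = "{..<0}"]) (use less in auto)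
qed

lemma has_derivative_superdisc_profile:
  assumes "\<bar>t\<bar> < 1"
  shows "(superdisc_profile s has_real_derivative - superdisc_slope s t) (at t)"
proof -
  have pos: "1 - \<bar>t\<bar> powr s > 0" using abs_powr_less_one[of s t] s assms by simp
  have "((\<lambda>t. 1 - \<bar>t\<bar> powr s) has_real_derivative
      0 - s * (max t 0 powr (s - 1) - max (- t) 0 powr (s - 1))) (at t)"
    by (intro DERIV_diff has_derivative_abs_powr) auto
  from DERIV_fun_powr[OF this pos, of "1 / s"]
  have "((\<lambda>t. (1 - \<bar>t\<bar> powr s) powr (1 / s)) has_real_derivative
      (1 / s) * (1 - \<bar>t\<bar> powr s) powr (1 / s - 1) *
      (0 - s * (max t 0 powr (s - 1) - max (- t) 0 powr (s - 1)))) (at t)"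
    by simp
  moreover have "(1 - \<bar>t\<bar> powr s) powr (1 / s - 1) = 1 / superdisc_profile s t powr (s - 1)"
  proof -
    have "superdisc_profile s t powr (s - 1) = (1 - \<bar>t\<bar> powr s) powr (1 / s * (s - 1))"
      by (simp add: superdisc_profile_def powr_powr)
    also have "1 / s * (s - 1) = - (1 / s - 1)" using s by (simp add: field_simps)
    finally show ?thesis unfolding powr_minus by (simp add: inverse_eq_divide)
  qed
  ultimately show ?thesis
    using s by (simp add: superdisc_slope_def superdisc_profile_def[abs_def])
qed

lemma continuous_on_superdisc_profile: "continuous_on {-1<..<1} (superdisc_profile s)"
proof (intro continuous_at_imp_continuous_on ballI)
  fix t :: real assume "t \<in> {-1<..<1}"
  then show "isCont (superdisc_profile s) t"
    by (intro DERIV_isCont[OF has_derivative_superdisc_profile]) auto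
qed

lemma C1_superdisc_profile: "superdisc_profile s C1_differentiable_on {-1<..<1}"
proof -
  have "continuous_on {-1<..<1} (\<lambda>t. - superdisc_slope s t)"
    unfolding superdisc_slope_def using s superdisc_profile_pos
    by (intro continuous_intros continuous_on_powr' continuous_on_superdisc_profile) (auto simp: abs_less_iff, fastforce+)
  then show ?thesis
    unfolding C1_differentiable_on_def
    using has_derivative_superdisc_profile
    by (intro exI[of _ "\<lambda>t. - superdisc_slope s t"]) (auto simp: has_real_derivative_iff_has_vector_derivative)
qed

lemma superdisc_slope_ge:
  assumes "0 < a" "a \<le> t" "t < 1"
  shows "a powr (s - 1) \<le> superdisc_slope s t"
proof -
  have "a powr (s - 1) \<le> t powr (s - 1)" using assms s by (intro powr_mono2) auto
  also have "\<dots> \<le> t powr (s - 1) / superdisc_profile s t powr (s - 1)"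
    using superdisc_profile_pos[of t] superdisc_profile_le_one[of t] powr_mono2[of "s-1" "superdisc_profile s t" 1] assms s
    by (simp add: divide_simps mult_left_le)
  finally show ?thesis using assms by (simp add: superdisc_slope_def)
qed

text \<open>On this part of the arc \<open>\<bar>t\<bar>\<close> is at most the height of the profile, so the arc is no steeper than the diagonal.\<close>

lemma superdisc_slope_le_one:
  assumes "\<bar>t\<bar> powr s \<le> 1 / 2"
  shows "\<bar>superdisc_slope s t\<bar> \<le> 1"
proof -
  have t: "\<bar>t\<bar> < 1" using assms abs_powr_less_one[of s t] s by simp
  have "\<bar>t\<bar> powr s \<le> superdisc_profile s t powr s"
    using superdisc_profile_powr[OF t] assms by simp
  then have "\<bar>t\<bar> \<le> superdisc_profile s t"
    using powr_less_mono2[of s "superdisc_profile s t" "\<bar>t\<bar>"] superdisc_profile_pos[OF t] s by force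
  then have "\<bar>t\<bar> powr (s - 1) \<le> superdisc_profile s t powr (s - 1)"
    using s by (intro powr_mono2) auto
  moreover have "\<bar>max t 0 powr (s - 1) - max (- t) 0 powr (s - 1)\<bar> = \<bar>t\<bar> powr (s - 1)"
    by (simp add: max_def)
  ultimately show ?thesis
    using superdisc_profile_pos[OF t] by (simp add: superdisc_slope_def divide_simps)
qed

end

text \<open>Four of the symmetries of the square: \<open>w\<close> says whether the coordinates are exchanged, and \<open>\<sigma> = - 1\<close>, as
opposed to \<open>\<sigma> = 1\<close>, adds a reflection of the second coordinate.
They suffice to move every boundary point of a superdisc to the middle part of its upper arc.\<close>

definition square_symmetry :: "bool \<Rightarrow> real \<Rightarrow> real ^ 2 \<Rightarrow> real ^ 2" where
  "square_symmetry w \<sigma> x = (if w then vector [x $ 2, \<sigma> * x $ 1] else vector [x $ 1, \<sigma> * x $ 2])"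

lemma square_symmetry_nth [simp]:
  "square_symmetry w \<sigma> x $ 1 = (if w then x $ 2 else x $ 1)"
  "square_symmetry w \<sigma> x $ 2 = \<sigma> * (if w then x $ 1 else x $ 2)"
  by (simp_all add: square_symmetry_def)

lemma orthogonal_transformation_square_symmetry:
  assumes "\<bar>\<sigma>\<bar> = 1" shows "orthogonal_transformation (square_symmetry w \<sigma>)"
proof -
  have "\<sigma> * \<sigma> = 1" using assms by (auto simp: abs_if split: if_splits)
  then have "(\<sigma> * a) * (\<sigma> * b) = a * b" for a b
    by (metis (no_types, lifting) mult.assoc mult.left_commute mult_1)
  then show ?thesis
    by (auto simp: orthogonal_transformation_def inner_vec_def sum_2 vec_eq_iff forall_2 algebra_simps
        intro!: linearI)
qed

lemma superdisc_gauge_square_symmetry: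
  "\<bar>\<sigma>\<bar> = 1 \<Longrightarrow> superdisc_gauge s (square_symmetry w \<sigma> x) = superdisc_gauge s x"
  by (simp add: superdisc_gauge_def abs_mult)

lemma superdisc_boundary_cases:
  assumes s: "s > 1" and x: "superdisc_gauge s x = 1"
  obtains w \<sigma> where "\<bar>\<sigma>\<bar> = 1" "square_symmetry w \<sigma> x $ 2 > 0"
    "\<bar>square_symmetry w \<sigma> x $ 1\<bar> powr s \<le> 1 / 2"
proof (cases "\<bar>x $ 1\<bar> powr s \<le> 1 / 2")
  case True
  with x have "x $ 2 \<noteq> 0" by (auto simp: superdisc_gauge_def)
  with that[of "sgn (x $ 2)" False] True show ?thesis by (auto simp: sgn_if split: if_splits)
next
  case False
  then have "x $ 1 \<noteq> 0" "\<bar>x $ 2\<bar> powr s \<le> 1 / 2" using x by (auto simp: superdisc_gauge_def)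
  with that[of "sgn (x $ 1)" True] show ?thesis by (auto simp: sgn_if split: if_splits)
qed

text \<open>After a symmetry the boundary point lies on the upper arc over \<open>(-a, a)\<close>, where \<open>a\<close> is the abscissa at which
the profile has height \<open>1/2\<close>. With the origin of the coordinates at the top \<open>(0, 1)\<close> and the vertical
half-width \<open>1\<close>, the box contains no point with \<open>x2 \<le> 0\<close>, so the lower arc stays outside, and the heights
between \<open>1/2\<close> and \<open>1\<close> meet the bound required of the graph function.\<close>

lemma C1_domain_superdisc:
  assumes s: "s > 1" shows "C1_domain (superdisc s)"
proof -
  define a where "a = (1 - (1/2) powr s) powr (1 / s)"
  have half: "(1/2 :: real) powr s < 1 / 2"
    using powr_less_mono'[of "1/2" 1 s] s by simp
  have half_pos: "(1/2 :: real) powr s > 0" by simp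
  have a_powr: "a powr s = 1 - (1/2) powr s" using s half by (simp add: a_def powr_powr)
  have a: "0 < a" "a < 1"
    using half half_pos powr_less_mono2[of "1/s" "1 - (1/2) powr s" 1] s by (auto simp: a_def)
  have profile_ge: "superdisc_profile s t \<ge> 1 / 2" if "\<bar>t\<bar> < a" for t
  proof -
    have "\<bar>t\<bar> powr s \<le> a powr s" using that s by (intro powr_mono2) auto
    then have "((1/2) powr s) powr (1/s) \<le> superdisc_profile s t"
      unfolding superdisc_profile_def using s a_powr by (intro powr_mono2) auto
    then show ?thesis using s by (simp add: powr_powr)
  qed
  have profile_le: "superdisc_profile s t \<le> 1" if "\<bar>t\<bar> < a" for t
    using superdisc_profile_le_one[OF s, of t] that a by simp
  have mem: "x \<in> superdisc s \<longleftrightarrow> superdisc_gauge s x < 1"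
    "x \<in> frontier (superdisc s) \<longleftrightarrow> superdisc_gauge s x = 1" for x
    using frontier_superdisc s by (simp_all add: superdisc_def)
  show ?thesis
    unfolding C1_domain_def
  proof (intro conjI ballI)
    show "superdisc s \<noteq> {}"
      using superdisc_gauge_scale[of s 0] s by (auto simp: superdisc_def superdisc_gauge_def intro!: exI[of _ 0])
    fix x0 assume "x0 \<in> frontier (superdisc s)"
    then have x0: "superdisc_gauge s x0 = 1" using frontier_superdisc s by simp
    then obtain w \<sigma> where \<sigma>: "\<bar>\<sigma>\<bar> = 1" and pos: "square_symmetry w \<sigma> x0 $ 2 > 0"
      and le: "\<bar>square_symmetry w \<sigma> x0 $ 1\<bar> powr s \<le> 1 / 2"
      by (rule superdisc_boundary_cases[OF s])
    define Q where "Q = square_symmetry w \<sigma>"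
    \<comment> \<open>the top \<open>(0, 1)\<close> in the coordinates given by \<open>Q\<close>\<close>
    define b :: "real ^ 2" where "b = (if w then vector [\<sigma>, 0] else vector [0, \<sigma>])"
    have "\<sigma> * \<sigma> = 1" using \<sigma> by (auto simp: abs_if split: if_splits)
    then have y: "Q (x - b) $ 1 = Q x $ 1" "Q (x - b) $ 2 = Q x $ 2 - 1" for x
      by (auto simp: Q_def b_def algebra_simps)
    have graph: "superdisc_gauge s x < 1 \<longleftrightarrow> Q x $ 2 < superdisc_profile s (Q x $ 1)"
      "superdisc_gauge s x = 1 \<longleftrightarrow> Q x $ 2 = superdisc_profile s (Q x $ 1)"
      if "\<bar>Q x $ 1\<bar> < a" "Q x $ 2 > 0" for x
      using superdisc_graph[OF s, of "Q x"] that a superdisc_gauge_square_symmetry[OF \<sigma>]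
      by (auto simp: Q_def simp del: square_symmetry_nth)
    have "\<bar>Q x0 $ 1\<bar> powr s < a powr s" using le a_powr half by (simp add: Q_def del: square_symmetry_nth)
    then have x0_1: "\<bar>Q x0 $ 1\<bar> < a" using powr_mono2[of s a "\<bar>Q x0 $ 1\<bar>"] a s by force
    have x0_2: "0 < Q x0 $ 2" "Q x0 $ 2 \<le> 1"
      using pos graph(2)[OF x0_1] profile_le[OF x0_1] x0 by (auto simp: Q_def simp del: square_symmetry_nth)
    show "\<exists>Q b a1 a2 \<phi>.
        let y = (\<lambda>x. Q (x - b));
            V = {x. y x $ 1 \<in> {-a1<..<a1} \<and> y x $ 2 \<in> {-a2<..<a2}}
        in orthogonal_transformation (Q :: real ^ 2 \<Rightarrow> real ^ 2) \<and>
           a1 > 0 \<and> a2 > 0 \<and> x0 \<in> V \<and>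
           (\<phi> :: real \<Rightarrow> real) C1_differentiable_on {-a1<..<a1} \<and>
           (\<forall>t \<in> {-a1<..<a1}. \<bar>\<phi> t\<bar> \<le> a2 / 2) \<and>
           superdisc s \<inter> V = {x \<in> V. y x $ 2 < \<phi> (y x $ 1)} \<and>
           frontier (superdisc s) \<inter> V = {x \<in> V. y x $ 2 = \<phi> (y x $ 1)}"
    proof (rule exI[of _ Q], rule exI[of _ b], rule exI[of _ a], rule exI[of _ 1],
        rule exI[of _ "\<lambda>t. superdisc_profile s t - 1"], unfold Let_def y, intro conjI)
      show "orthogonal_transformation Q" unfolding Q_def by (rule orthogonal_transformation_square_symmetry[OF \<sigma>])
      show "x0 \<in> {x. Q x $ 1 \<in> {- a<..<a} \<and> Q x $ 2 - 1 \<in> {- 1<..<1}}"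
        using x0_1 x0_2 by (simp add: abs_less_iff)
      have "superdisc_profile s C1_differentiable_on {-a<..<a}"
        by (rule C1_differentiable_on_subset[OF C1_superdisc_profile[OF s]]) (use a in auto)
      then show "(\<lambda>t. superdisc_profile s t - 1) C1_differentiable_on {-a<..<a}"
        by (intro C1_differentiable_on_diff) auto
      show "\<forall>t\<in>{- a<..<a}. \<bar>superdisc_profile s t - 1\<bar> \<le> 1 / 2"
      proof
        fix t assume "t \<in> {- a<..<a}"
        then show "\<bar>superdisc_profile s t - 1\<bar> \<le> 1 / 2" using profile_ge[of t] profile_le[of t] by (auto simp: abs_if)
      qed
    qed (use a graph mem in \<open>auto simp: abs_less_iff\<close>)
  qed (use s open_superdisc connected_superdisc in auto)
qed

text \<open>The boundary is the union of four congruent arcs, each parametrised with Lipschitz constant \<open>2\<close> over the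
abscissae with \<open>\<bar>t\<bar> powr s \<le> 1/2\<close>, where the slope is at most \<open>1\<close>.\<close>

lemma hausdorff1_frontier_superdisc_finite:
  assumes s: "s > 1" shows "emeasure hausdorff1 (frontier (superdisc s)) < \<infinity>"
proof -
  define h where "h = (1/2 :: real) powr (1 / s)"
  have h: "0 < h" "h powr s = 1 / 2" using s by (auto simp: h_def powr_powr)
  have h1: "h < 1" using abs_powr_less_one[of s h] h s by simp
  have slope: "\<bar>superdisc_slope s t\<bar> \<le> 1" if "t \<in> {-h..h}" for t
  proof (rule superdisc_slope_le_one[OF s])
    show "\<bar>t\<bar> powr s \<le> 1 / 2" using powr_mono2[of s "\<bar>t\<bar>" h] h s that by auto
  qed
  have profile_lip: "\<bar>superdisc_profile s t - superdisc_profile s u\<bar> \<le> \<bar>t - u\<bar>" if "t \<in> {-h..h}" "u \<in> {-h..h}" for t u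
  proof -
    have "norm (superdisc_profile s t - superdisc_profile s u) \<le> 1 * norm (t - u)"
    proof (rule field_differentiable_bound[of "{-h..h}"])
      show "(superdisc_profile s has_real_derivative - superdisc_slope s z) (at z within {-h..h})" if "z \<in> {-h..h}" for z
        by (rule has_field_derivative_at_within[OF has_derivative_superdisc_profile[OF s]]) (use that h1 in auto)
      show "norm (- superdisc_slope s z) \<le> 1" if "z \<in> {-h..h}" for z using slope[OF that] by simp
    qed (use that in auto)
    then show ?thesis by simp
  qed
  define \<gamma> :: "bool \<Rightarrow> real \<Rightarrow> real \<Rightarrow> real ^ 2" where
    "\<gamma> w \<sigma> t = (if w then vector [\<sigma> * superdisc_profile s t, t] else vector [t, \<sigma> * superdisc_profile s t])" for w \<sigma> t
  have lip: "2-lipschitz_on {-h..h} (\<gamma> w \<sigma>)" if "\<bar>\<sigma>\<bar> = 1" for w \<sigma>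
  proof (rule lipschitz_onI)
    fix t u assume tu: "t \<in> {-h..h}" "u \<in> {-h..h}"
    have "dist (\<gamma> w \<sigma> t) (\<gamma> w \<sigma> u) \<le> \<bar>(\<gamma> w \<sigma> t - \<gamma> w \<sigma> u) $ 1\<bar> + \<bar>(\<gamma> w \<sigma> t - \<gamma> w \<sigma> u) $ 2\<bar>"
      using norm_le_l1_cart[of "\<gamma> w \<sigma> t - \<gamma> w \<sigma> u"] by (simp add: sum_2 dist_norm)
    also have "\<dots> = \<bar>t - u\<bar> + \<bar>superdisc_profile s t - superdisc_profile s u\<bar>"
      using that by (auto simp: \<gamma>_def abs_mult simp flip: right_diff_distrib)
    also have "\<dots> \<le> 2 * dist t u" using profile_lip[OF tu] by (simp add: dist_real_def)
    finally show "dist (\<gamma> w \<sigma> t) (\<gamma> w \<sigma> u) \<le> 2 * dist t u" .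
  qed simp
  have meas: "\<gamma> w \<sigma> ` {-h..h} \<in> sets borel" if "\<bar>\<sigma>\<bar> = 1" for w \<sigma>
    by (intro borel_compact compact_continuous_image lipschitz_on_continuous_on[OF lip[OF that]]) simp
  define P where "P = (UNIV :: bool set) \<times> {1, -1 :: real}"
  have "frontier (superdisc s) \<subseteq> (\<Union>p\<in>P. (\<lambda>(w, \<sigma>). \<gamma> w \<sigma> ` {-h..h}) p)"
  proof
    fix x assume "x \<in> frontier (superdisc s)"
    then have x: "superdisc_gauge s x = 1" using frontier_superdisc s by simp
    then obtain w \<sigma> where \<sigma>: "\<bar>\<sigma>\<bar> = 1" and pos: "square_symmetry w \<sigma> x $ 2 > 0"
      and le: "\<bar>square_symmetry w \<sigma> x $ 1\<bar> powr s \<le> 1 / 2"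
      by (rule superdisc_boundary_cases[OF s])
    define t where "t = square_symmetry w \<sigma> x $ 1"
    have "\<bar>t\<bar> \<le> h" using powr_less_mono2[of s h "\<bar>t\<bar>"] le h s by (force simp: t_def simp del: square_symmetry_nth)
    then have "\<bar>t\<bar> < 1" using h1 by simp
    then have "square_symmetry w \<sigma> x $ 2 = superdisc_profile s t"
      using superdisc_graph(2)[OF s, of "square_symmetry w \<sigma> x"] pos x superdisc_gauge_square_symmetry[OF \<sigma>]
      by (simp add: t_def del: square_symmetry_nth)
    then have "\<sigma> * square_symmetry w \<sigma> x $ 2 = \<sigma> * superdisc_profile s t" by (simp only:)
    moreover have "\<sigma> * (\<sigma> * z) = z" for z using \<sigma> by (auto simp: abs_if split: if_splits)
    ultimately have "x = \<gamma> w \<sigma> t"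
      by (auto simp: vec_eq_iff forall_2 \<gamma>_def t_def)
    moreover have "\<sigma> \<in> {1, -1}" using \<sigma> by (auto simp: abs_if split: if_splits)
    ultimately show "x \<in> (\<Union>p\<in>P. (\<lambda>(w, \<sigma>). \<gamma> w \<sigma> ` {-h..h}) p)"
      using \<open>\<bar>t\<bar> \<le> h\<close> by (intro UN_I[of "(w, \<sigma>)"]) (auto simp: P_def intro!: imageI)
  qed
  then have "emeasure hausdorff1 (frontier (superdisc s)) \<le> emeasure hausdorff1 (\<Union>p\<in>P. (\<lambda>(w, \<sigma>). \<gamma> w \<sigma> ` {-h..h}) p)"
    by (intro emeasure_mono) (auto intro!: sets.finite_UN meas simp: P_def)
  also have "\<dots> \<le> (\<Sum>p\<in>P. emeasure hausdorff1 ((\<lambda>(w, \<sigma>). \<gamma> w \<sigma> ` {-h..h}) p))"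
    by (intro emeasure_subadditive_finite) (auto intro!: meas simp: P_def)
  also have "\<dots> \<le> (\<Sum>p\<in>P. ennreal (2 * (h - (- h))))"
  proof (intro sum_mono)
    fix p assume "p \<in> P"
    then obtain w \<sigma> where p: "p = (w, \<sigma>)" "\<bar>\<sigma>\<bar> = 1" by (auto simp: P_def)
    then show "emeasure hausdorff1 ((\<lambda>(w, \<sigma>). \<gamma> w \<sigma> ` {-h..h}) p) \<le> ennreal (2 * (h - (- h)))"
      using hausdorff1_outer_lipschitz_interval[OF lip] by (simp add: emeasure_hausdorff1[OF meas])
  qed
  also have "\<dots> < \<infinity>" by (simp add: P_def ennreal_mult_less_top)
  finally show ?thesis .
qed

section \<open>Interior and boundary integrals of an exponential\<close>

lemma continuous_on_vector2 [continuous_intros]: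
  assumes "continuous_on S f" "continuous_on S g"
  shows "continuous_on S (\<lambda>x. vector [f x, g x] :: real ^ 2)"
proof -
  have "continuous_on S (\<lambda>x. if i = 1 then f x else g x)" for i :: 2
    using assms by (cases "i = 1") auto
  then have "continuous_on S (\<lambda>x. (\<chi> i. if i = 1 then f x else g x) :: real ^ 2)"
    by (rule continuous_on_vec_lambda)
  also have "(\<lambda>x. (\<chi> i. if i = 1 then f x else g x) :: real ^ 2) = (\<lambda>x. vector [f x, g x])"
    by (auto simp: fun_eq_iff vec_eq_iff forall_2)
  finally show ?thesis .
qed

lemma measurable_vector2:
  "(\<lambda>(t, y). vector [t, y] :: real ^ 2) \<in> borel_measurable (lborel \<Otimes>\<^sub>M lborel)"
  unfolding split_def by (simp add: lborel_prod borel_measurable_continuous_onI continuous_intros)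

lemma lborel_real2: "lborel = distr (lborel \<Otimes>\<^sub>M lborel) borel (\<lambda>(t, y). vector [t, y] :: real ^ 2)"
proof (rule lborel_eqI)
  note M [measurable] = measurable_vector2
  fix l u :: "real ^ 2"
  assume lu: "\<And>b. b \<in> Basis \<Longrightarrow> l \<bullet> b \<le> u \<bullet> b"
  have le: "l $ i \<le> u $ i" for i
    using lu[of "axis i 1"] by (simp add: inner_axis axis_in_Basis_iff)
  have "(\<lambda>(t, y). vector [t, y]) -` box l u = box (l $ 1) (u $ 1) \<times> box (l $ 2) (u $ 2)"
    by (auto simp: mem_box_cart forall_2)
  then have "emeasure (distr (lborel \<Otimes>\<^sub>M lborel) borel (\<lambda>(t, y). vector [t, y] :: real ^ 2)) (box l u)
      = emeasure (lborel \<Otimes>\<^sub>M lborel) (box (l $ 1) (u $ 1) \<times> box (l $ 2) (u $ 2))"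
    by (subst emeasure_distr) (auto simp: space_pair_measure)
  also have "\<dots> = ennreal ((u $ 1 - l $ 1) * (u $ 2 - l $ 2))"
    using le by (subst lborel.emeasure_pair_measure_Times) (auto simp: ennreal_mult)
  also have "(u $ 1 - l $ 1) * (u $ 2 - l $ 2) = (\<Prod>b\<in>Basis. (u - l) \<bullet> b)"
  proof -
    have "(\<Prod>b\<in>Basis. (u - l) \<bullet> b) = (\<Prod>i\<in>UNIV. (u - l) $ i)"
      by (subst prod.reindex_bij_betw[of "\<lambda>i. axis i 1" UNIV Basis, symmetric])
         (auto simp: inner_axis bij_betw_def inj_on_def axis_eq_axis Basis_vec_def)
    then show ?thesis by (simp add: UNIV_2)
  qed
  finally show "emeasure (distr (lborel \<Otimes>\<^sub>M lborel) borel (\<lambda>(t, y). vector [t, y] :: real ^ 2)) (box l u)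
      = ennreal (\<Prod>b\<in>Basis. (u - l) \<bullet> b)" .
qed simp

lemma nn_integral_lborel_real2:
  assumes [measurable]: "f \<in> borel_measurable borel"
  shows "(\<integral>\<^sup>+x. f x \<partial>lborel) = (\<integral>\<^sup>+t. \<integral>\<^sup>+y. f (vector [t, y] :: real ^ 2) \<partial>lborel \<partial>lborel)"
proof -
  note M [measurable] = measurable_vector2
  have "(\<integral>\<^sup>+x. f x \<partial>lborel) = (\<integral>\<^sup>+p. f (case p of (t, y) \<Rightarrow> vector [t, y]) \<partial>(lborel \<Otimes>\<^sub>M lborel))"
    by (subst lborel_real2, subst nn_integral_distr) (auto simp: M)
  also have "\<dots> = (\<integral>\<^sup>+t. \<integral>\<^sup>+y. f (vector [t, y]) \<partial>lborel \<partial>lborel)"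
    by (subst lborel.nn_integral_fst[symmetric]) (auto intro!: measurable_compose[OF M])
  finally show ?thesis .
qed

lemma borel_measurable_superdisc_profile [measurable]: "superdisc_profile s \<in> borel_measurable borel"
  unfolding superdisc_profile_def by measurable

text \<open>Below a boundary point of height \<open>c\<close>, the integral of \<open>exp (k y)\<close> along the vertical line is at most
\<open>exp (k c) / k\<close>.\<close>

lemma nn_integral_superdisc_exp_le:
  assumes s: "s > 1" and k: "k > 0"
  shows "ennreal k * (\<integral>\<^sup>+x\<in>superdisc s. exp (k * x $ 2) \<partial>lborel)
    \<le> (\<integral>\<^sup>+t\<in>{-1<..<1}. exp (k * superdisc_profile s t) \<partial>lborel)"
proof -
  have [measurable]: "superdisc s \<in> sets borel" using open_superdisc s by auto
  have inner: "ennreal k * (\<integral>\<^sup>+y. ennreal (exp (k * y)) * indicator (superdisc s) (vector [t, y] :: real ^ 2) \<partial>lborel)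
      \<le> ennreal (exp (k * superdisc_profile s t)) * indicator {-1<..<1} t" for t
  proof (cases "\<bar>t\<bar> < 1")
    case False
    have "(vector [t, y] :: real ^ 2) \<notin> superdisc s" for y
      using abs_powr_less_one[of s t] False s powr_ge_zero[of "\<bar>y\<bar>" s]
      by (simp add: superdisc_def superdisc_gauge_def not_less del: powr_ge_zero)
    then show ?thesis by simp
  next
    case True
    define c where "c = superdisc_profile s t"
    have c: "0 < c" using superdisc_profile_pos[OF s True] by (simp add: c_def)
    have "(\<integral>\<^sup>+y. ennreal (exp (k * y)) * indicator (superdisc s) (vector [t, y] :: real ^ 2) \<partial>lborel)
        \<le> (\<integral>\<^sup>+y. ennreal (exp (k * y)) * indicator {-1..c} y \<partial>lborel)"
    proof (rule nn_integral_mono)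
      fix y
      have "y \<in> {-1..c}" if "vector [t, y] \<in> superdisc s"
        using superdisc_component_bound[of s "vector [t, y]" 2] superdisc_graph(1)[OF s, of "vector [t, y]"] that True s c
        by (cases "y \<le> 0") (auto simp: superdisc_def c_def abs_le_iff)
      then show "ennreal (exp (k * y)) * indicator (superdisc s) (vector [t, y] :: real ^ 2)
          \<le> ennreal (exp (k * y)) * indicator {-1..c} y"
        by (auto simp: indicator_def)
    qed
    also have "\<dots> = ennreal (exp (k * c) / k - exp (k * (-1)) / k)"
      using k c by (intro nn_integral_FTC_Icc) (auto intro!: derivative_eq_intros simp: has_real_derivative_iff_has_vector_derivative[symmetric])
    also have "\<dots> \<le> ennreal (exp (k * c) / k)"
      using k by (intro ennreal_leI) auto
    finally have "ennreal k * (\<integral>\<^sup>+y. ennreal (exp (k * y)) * indicator (superdisc s) (vector [t, y] :: real ^ 2) \<partial>lborel)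
        \<le> ennreal k * ennreal (exp (k * c) / k)"
      by (rule mult_left_mono) simp
    also have "\<dots> = ennreal (exp (k * c))" using k by (simp add: ennreal_mult[symmetric])
    finally show ?thesis using True by (simp add: c_def abs_less_iff)
  qed
  have "ennreal k * (\<integral>\<^sup>+x\<in>superdisc s. exp (k * x $ 2) \<partial>lborel)
    = (\<integral>\<^sup>+t. ennreal k * (\<integral>\<^sup>+y. ennreal (exp (k * y)) * indicator (superdisc s) (vector [t, y] :: real ^ 2) \<partial>lborel) \<partial>lborel)"
  proof -
    have "(\<lambda>y. vector [t, y] :: real ^ 2) \<in> borel_measurable borel" for t
      by (intro borel_measurable_continuous_onI continuous_intros)
    then have [measurable]: "(\<lambda>y. indicator (superdisc s) (vector [t, y]) :: ennreal) \<in> borel_measurable borel" for t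
      by (rule measurable_compose) simp
    have "ennreal k * (\<integral>\<^sup>+x\<in>superdisc s. exp (k * x $ 2) \<partial>lborel)
        = (\<integral>\<^sup>+x. ennreal k * (ennreal (exp (k * x $ 2)) * indicator (superdisc s) x) \<partial>lborel)"
      by (rule nn_integral_cmult[symmetric]) simp
    also have "\<dots> = (\<integral>\<^sup>+t. \<integral>\<^sup>+y. ennreal k * (ennreal (exp (k * y)) * indicator (superdisc s) (vector [t, y] :: real ^ 2)) \<partial>lborel \<partial>lborel)"
      by (subst nn_integral_lborel_real2) auto
    finally show ?thesis by (simp add: nn_integral_cmult)
  qed
  also have "\<dots> \<le> (\<integral>\<^sup>+t\<in>{-1<..<1}. exp (k * superdisc_profile s t) \<partial>lborel)"
    by (intro nn_integral_mono inner)
  finally show ?thesis .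
qed

text \<open>On the upper arc the first coordinate is a contraction. Over \<open>[a, 2a]\<close> it even contracts by the factor
\<open>sqrt (1 + m\<^sup>2)\<close>, because two points of the arc at horizontal distance \<open>h\<close> differ in height by at least \<open>m h\<close>.\<close>

lemma nn_integral_superdisc_boundary_exp_ge:
  assumes s: "s > 1" and a: "0 < a" "2 * a < 1"
  shows "(\<integral>\<^sup>+t\<in>{-1<..<1} - {a..2*a}. exp (k * superdisc_profile s t) \<partial>lborel)
      + ennreal (sqrt (1 + (a powr (s - 1))\<^sup>2)) * (\<integral>\<^sup>+t\<in>{a..2*a}. exp (k * superdisc_profile s t) \<partial>lborel)
    \<le> (\<integral>\<^sup>+x\<in>frontier (superdisc s). exp (k * x $ 2) \<partial>hausdorff1)"
proof -
  \<comment> \<open>a lower bound for the slope of the arc over \<open>[a, 2a]\<close>\<close>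
  define m where "m = a powr (s - 1)"
  define T where "T x = x $ 1" for x :: "real ^ 2"
  have [measurable]: "T \<in> borel_measurable borel" unfolding T_def
    by (intro borel_measurable_continuous_onI continuous_intros)
  define E where "E A = {x \<in> frontier (superdisc s). T x \<in> A \<and> x $ 2 > 0}" for A
  have comp [measurable]: "(\<lambda>x :: real^2. x $ i) \<in> borel_measurable borel" for i
    by (intro borel_measurable_continuous_onI continuous_intros)
  have fr [measurable]: "frontier (superdisc s) \<in> sets borel" by (intro borel_closed) simp
  have E_meas [measurable]: "E A \<in> sets borel" if [measurable]: "A \<in> sets borel" for A
    unfolding E_def by measurable
  have E_graph: "x $ 2 = superdisc_profile s (T x)" if "x \<in> E A" "A \<subseteq> {-1<..<1}" for x A
    using superdisc_graph(2)[OF s, of x] that s by (auto simp: E_def T_def frontier_superdisc subset_iff abs_less_iff)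
  have E_onto: "A \<subseteq> T ` E A" if "A \<subseteq> {-1<..<1}" for A
  proof
    fix t assume t: "t \<in> A"
    with that have "t \<in> {-1<..<1}" by blast
    then have t1: "\<bar>t\<bar> < 1" by auto
    have "vector [t, superdisc_profile s t] \<in> E A"
      using superdisc_graph(2)[OF s, of "vector [t, superdisc_profile s t]"] t1 t superdisc_profile_pos[OF s t1] s
      by (simp add: E_def T_def frontier_superdisc)
    then show "t \<in> T ` E A" by (rule rev_image_eqI) (simp add: T_def)
  qed
  have int: "ennreal K * (\<integral>\<^sup>+t\<in>A. exp (k * superdisc_profile s t) \<partial>lborel) \<le> (\<integral>\<^sup>+x\<in>E A. exp (k * x $ 2) \<partial>hausdorff1)"
    if K: "K > 0" and A: "A \<in> sets borel" "A \<subseteq> {-1<..<1}"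
      and T: "\<And>x y. x \<in> E A \<Longrightarrow> y \<in> E A \<Longrightarrow> K * \<bar>T x - T y\<bar> \<le> dist x y" for K A
  proof -
    have "ennreal K * (\<integral>\<^sup>+t\<in>A. ennreal (exp (k * superdisc_profile s t)) \<partial>lborel)
        \<le> (\<integral>\<^sup>+x\<in>E A. ennreal (exp (k * superdisc_profile s (T x))) \<partial>hausdorff1)"
      by (rule nn_integral_hausdorff1_ge[OF K T]) (use A E_onto in auto)
    also have "\<dots> = (\<integral>\<^sup>+x\<in>E A. exp (k * x $ 2) \<partial>hausdorff1)"
      by (intro nn_integral_cong) (use E_graph[OF _ A(2)] in \<open>auto simp: indicator_def\<close>)
    finally show ?thesis .
  qed
  define J where "J = {a..2*a}"
  have J: "J \<subseteq> {-1<..<1}" "J \<in> sets borel" using a by (auto simp: J_def)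
  have "(\<integral>\<^sup>+t\<in>{-1<..<1} - J. exp (k * superdisc_profile s t) \<partial>lborel) \<le> (\<integral>\<^sup>+x\<in>E ({-1<..<1} - J). exp (k * x $ 2) \<partial>hausdorff1)"
  proof -
    have "1 * \<bar>T x - T y\<bar> \<le> dist x y" for x y
      using dist_vec_nth_le[of x 1 y] by (simp add: T_def dist_real_def)
    then show ?thesis using int[of 1 "{-1<..<1} - J"] J(2) by simp
  qed
  moreover have "ennreal (sqrt (1 + m\<^sup>2)) * (\<integral>\<^sup>+t\<in>J. exp (k * superdisc_profile s t) \<partial>lborel) \<le> (\<integral>\<^sup>+x\<in>E J. exp (k * x $ 2) \<partial>hausdorff1)"
  proof (rule int[OF _ J(2) J(1)])
    show "sqrt (1 + m\<^sup>2) > 0" by (simp add: add_pos_nonneg)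
    have wlog: "m * (u - t) \<le> superdisc_profile s t - superdisc_profile s u" if tu: "t \<in> J" "u \<in> J" "t < u" for t u
    proof -
      obtain z where z: "t < z" "z < u"
        "superdisc_profile s u - superdisc_profile s t = (u - t) * (- superdisc_slope s z)"
        using MVT2[OF \<open>t < u\<close>, of "superdisc_profile s" "\<lambda>z. - superdisc_slope s z"]
          has_derivative_superdisc_profile[OF s] tu a by (force simp: J_def)
      have "m \<le> superdisc_slope s z"
        unfolding m_def using superdisc_slope_ge[OF s, of a z] z that a by (auto simp: J_def)
      then have "(u - t) * m \<le> (u - t) * superdisc_slope s z"
        using that by (intro mult_left_mono) auto
      then have "m * (u - t) \<le> - ((u - t) * (- superdisc_slope s z))"
        by (simp only: mult_minus_right minus_minus mult.commute[of m])
      then show ?thesis using z(3) by linarith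
    qed
    fix x y assume xy: "x \<in> E J" "y \<in> E J"
    have "m * \<bar>T x - T y\<bar> \<le> \<bar>x $ 2 - y $ 2\<bar>"
      using wlog[of "T x" "T y"] wlog[of "T y" "T x"] E_graph[OF _ J(1)] xy
      by (cases "T x" "T y" rule: linorder_cases) (force simp: E_def)+
    moreover have "m \<ge> 0" by (simp add: m_def)
    ultimately have "(m * \<bar>T x - T y\<bar>)\<^sup>2 \<le> \<bar>x $ 2 - y $ 2\<bar>\<^sup>2"
      by (intro power_mono) auto
    then have "(1 + m\<^sup>2) * (T x - T y)\<^sup>2 \<le> (x $ 1 - y $ 1)\<^sup>2 + (x $ 2 - y $ 2)\<^sup>2"
      by (simp add: T_def algebra_simps power_mult_distrib)
    then have "sqrt ((1 + m\<^sup>2) * (T x - T y)\<^sup>2) \<le> sqrt ((x $ 1 - y $ 1)\<^sup>2 + (x $ 2 - y $ 2)\<^sup>2)"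
      by (rule real_sqrt_le_mono)
    then show "sqrt (1 + m\<^sup>2) * \<bar>T x - T y\<bar> \<le> dist x y"
      by (simp add: real_sqrt_mult dist_norm norm_vec_def L2_set_def sum_2)
  qed
  ultimately have "(\<integral>\<^sup>+t\<in>{-1<..<1} - J. exp (k * superdisc_profile s t) \<partial>lborel)
      + ennreal (sqrt (1 + m\<^sup>2)) * (\<integral>\<^sup>+t\<in>J. exp (k * superdisc_profile s t) \<partial>lborel)
    \<le> (\<integral>\<^sup>+x\<in>E ({-1<..<1} - J). exp (k * x $ 2) \<partial>hausdorff1) + (\<integral>\<^sup>+x\<in>E J. exp (k * x $ 2) \<partial>hausdorff1)"
    by (rule add_mono)
  also have "\<dots> = (\<integral>\<^sup>+x. ennreal (exp (k * x $ 2)) * indicator (E ({-1<..<1} - J)) x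
      + ennreal (exp (k * x $ 2)) * indicator (E J) x \<partial>hausdorff1)"
    using J(2) by (subst nn_integral_add) auto
  also have "\<dots> \<le> (\<integral>\<^sup>+x\<in>frontier (superdisc s). exp (k * x $ 2) \<partial>hausdorff1)"
    by (intro nn_integral_mono) (auto simp: indicator_def E_def)
  finally show ?thesis by (simp add: J_def m_def)
qed

text \<open>The relation \<open>k a\<^sup>s = p\<close> makes \<open>a\<close> the natural length: \<open>k \<bar>t\<bar>\<^sup>s = p z\<^sup>s\<close> for \<open>z = \<bar>t\<bar> / a\<close>. With
\<open>z - 1 \<le> z\<^sup>s\<close> the exponent \<open>k \<phi>(t)\<close> is at most \<open>k + p / s - p z / s\<close>, which bounds the full integral
by a constant times \<open>a exp k\<close>; on \<open>[a, 2a]\<close> the exponent is at least \<open>k - p 2\<^sup>s\<close>, which bounds the other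
integral from below by a constant times \<open>a exp k\<close>.\<close>

lemma superdisc_weight_concentration:
  assumes s: "s > 1" and p: "p > 0" and a: "0 < a" "2 * a < 1" and k: "k * a powr s = p"
  defines "c \<equiv> p * exp (- (p * 2 powr s) - p / s) / (2 * s)"
  shows "ennreal c * (\<integral>\<^sup>+t\<in>{-1<..<1}. exp (k * superdisc_profile s t) \<partial>lborel)
    \<le> (\<integral>\<^sup>+t\<in>{a..2*a}. exp (k * superdisc_profile s t) \<partial>lborel)"
proof -
  define b where "b = p / (s * a)"
  have b: "b > 0" using s p a by (simp add: b_def)
  have "k > 0" using k p a zero_less_mult_pos2[of k "a powr s"] by (simp add: zero_less_mult_iff)
  have upper: "k * superdisc_profile s t \<le> k + p / s - b * \<bar>t\<bar>" if "t \<in> {-1<..<1}" for t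
  proof -
    define z where "z = \<bar>t\<bar> / a"
    have z: "z \<ge> 0" using a by (simp add: z_def)
    have zs: "z - 1 \<le> z powr s"
    proof (cases "z \<ge> 1")
      case True
      then have "z powr 1 \<le> z powr s" using s by (intro powr_mono) auto
      then show ?thesis using True by simp
    next
      case False
      then show ?thesis using powr_ge_zero[of z s] by linarith
    qed
    have "k * superdisc_profile s t \<le> k * (1 - \<bar>t\<bar> powr s / s)"
      using superdisc_profile_le[OF s, of t] that \<open>k > 0\<close> by (intro mult_left_mono) auto
    also have "\<dots> = k - k * a powr s * z powr s / s"
      using a by (simp add: z_def powr_divide right_diff_distrib)
    also have "\<dots> = k - p / s * z powr s" by (simp add: k)
    also have "\<dots> \<le> k - p / s * (z - 1)"
      using zs p s by (intro diff_left_mono mult_left_mono) auto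
    also have "\<dots> = k + p / s - b * \<bar>t\<bar>"
      by (simp add: z_def b_def right_diff_distrib)
    finally show ?thesis .
  qed
  have "(\<integral>\<^sup>+t\<in>{-1<..<1}. exp (k * superdisc_profile s t) \<partial>lborel)
      \<le> (\<integral>\<^sup>+t. ennreal (exp (k + p / s)) * (ennreal (exp (b * t)) * indicator {-1..0} t
            + ennreal (exp (- b * t)) * indicator {0..1} t) \<partial>lborel)"
  proof (rule nn_integral_mono)
    fix t
    show "ennreal (exp (k * superdisc_profile s t)) * indicator {-1<..<1} t
      \<le> ennreal (exp (k + p / s)) * (ennreal (exp (b * t)) * indicator {-1..0} t
            + ennreal (exp (- b * t)) * indicator {0..1} t)"
    proof (cases "t \<in> {-1<..<1}")
      case True
      have "ennreal (exp (k * superdisc_profile s t)) \<le> ennreal (exp (k + p / s)) * ennreal (exp (- b * \<bar>t\<bar>))"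
        using upper[OF True] by (simp add: ennreal_mult[symmetric] exp_add[symmetric])
      also have "ennreal (exp (- b * \<bar>t\<bar>)) \<le> ennreal (exp (b * t)) * indicator {-1..0} t
            + ennreal (exp (- b * t)) * indicator {0..1} t"
        using True by (cases "t \<le> 0") (auto simp: indicator_def)
      finally show ?thesis using True by (simp add: mult_left_mono)
    qed auto
  qed
  also have "\<dots> = ennreal (exp (k + p / s)) * ((\<integral>\<^sup>+t\<in>{-1..0}. exp (b * t) \<partial>lborel)
            + (\<integral>\<^sup>+t\<in>{0..1}. exp (- b * t) \<partial>lborel))"
    by (subst nn_integral_cmult, simp, subst nn_integral_add) auto
  also have "(\<integral>\<^sup>+t\<in>{-1..0}. exp (b * t) \<partial>lborel) = ennreal (exp (b * 0) / b - exp (b * (-1)) / b)"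
    using b by (intro nn_integral_FTC_Icc)
      (auto intro!: derivative_eq_intros simp: has_real_derivative_iff_has_vector_derivative[symmetric])
  also have "(\<integral>\<^sup>+t\<in>{0..1}. exp (- b * t) \<partial>lborel) = ennreal (- exp (- b * 1) / b - (- exp (- b * 0) / b))"
    using b by (intro nn_integral_FTC_Icc)
      (auto intro!: derivative_eq_intros simp: has_real_derivative_iff_has_vector_derivative[symmetric])
  also have "ennreal (exp (k + p / s)) * (ennreal (exp (b * 0) / b - exp (b * (-1)) / b)
      + ennreal (- exp (- b * 1) / b - (- exp (- b * 0) / b)))
      \<le> ennreal (exp (k + p / s)) * (ennreal (1 / b) + ennreal (1 / b))"
    using b by (intro mult_left_mono add_mono ennreal_leI) auto
  also have "\<dots> = ennreal (exp (k + p / s) * (2 / b))"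
    using b by (simp add: ennreal_mult[symmetric] ennreal_plus[symmetric] del: ennreal_plus)
  finally have "ennreal c * (\<integral>\<^sup>+t\<in>{-1<..<1}. exp (k * superdisc_profile s t) \<partial>lborel)
      \<le> ennreal c * ennreal (exp (k + p / s) * (2 / b))"
    by (rule mult_left_mono) simp
  also have "\<dots> = ennreal (exp (k - p * 2 powr s)) * ennreal a"
  proof -
    define X where "X = exp (- (p * 2 powr s) - p / s)"
    have "c * (exp (k + p / s) * (2 / b)) = exp (k + p / s) * X * a"
      using s p a by (simp add: c_def b_def X_def[symmetric])
    also have "exp (k + p / s) * X = exp (k - p * 2 powr s)"
      by (simp add: X_def flip: exp_add)
    finally have "c * (exp (k + p / s) * (2 / b)) = exp (k - p * 2 powr s) * a" .
    moreover have "c \<ge> 0" using s p by (simp add: c_def)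
    ultimately show ?thesis using b a by (simp add: ennreal_mult[symmetric])
  qed
  also have "\<dots> = (\<integral>\<^sup>+t\<in>{a..2*a}. ennreal (exp (k - p * 2 powr s)) \<partial>lborel)"
    using a by (simp add: nn_integral_cmult)
  also have "\<dots> \<le> (\<integral>\<^sup>+t\<in>{a..2*a}. exp (k * superdisc_profile s t) \<partial>lborel)"
  proof (rule nn_integral_mono)
    fix t
    have "k - p * 2 powr s \<le> k * superdisc_profile s t" if "t \<in> {a..2*a}"
    proof -
      have "t powr s \<le> (2 * a) powr s" using that a s by (intro powr_mono2) auto
      then have "k * t powr s \<le> k * (2 * a) powr s" using \<open>k > 0\<close> by simp
      also have "\<dots> = (k * a powr s) * 2 powr s" using a by (simp add: powr_mult)
      also have "\<dots> = p * 2 powr s" by (simp only: k)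
      finally have "k - p * 2 powr s \<le> k * (1 - \<bar>t\<bar> powr s)" using that a by (simp add: right_diff_distrib)
      also have "\<dots> \<le> k * superdisc_profile s t"
        using superdisc_profile_ge[OF s, of t] that a \<open>k > 0\<close> by (intro mult_left_mono) auto
      finally show ?thesis .
    qed
    then show "ennreal (exp (k - p * 2 powr s)) * indicator {a..2*a} t
        \<le> ennreal (exp (k * superdisc_profile s t)) * indicator {a..2*a} t"
      by (auto simp: indicator_def)
  qed
  finally show ?thesis .
qed

section \<open>The Robin eigenvalue of a superdisc\<close>

text \<open>With \<open>W\<close> the integral of the weight over \<open>(-1, 1)\<close> and \<open>W'\<close> that over \<open>[a, 2a]\<close>, the boundary integral is at
least \<open>W + (K - 1) W'\<close>, which is at least \<open>(1 + (K - 1) c) W\<close> by concentration, and \<open>W\<close> dominates \<open>k\<close> times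
the interior integral.\<close>

lemma superdisc_boundary_interior_ratio:
  assumes s: "s > 1" and p: "p > 0" and a: "0 < a" "2 * a < 1" and k: "k * a powr s = p"
  defines "c \<equiv> p * exp (- (p * 2 powr s) - p / s) / (2 * s)"
  defines "K \<equiv> sqrt (1 + (a powr (s - 1))\<^sup>2)"
  shows "ennreal ((1 + (K - 1) * c) * k) * (\<integral>\<^sup>+x\<in>superdisc s. exp (k * x $ 2) \<partial>lborel)
    \<le> (\<integral>\<^sup>+x\<in>frontier (superdisc s). exp (k * x $ 2) \<partial>hausdorff1)"
proof -
  have "k > 0" using k p a zero_less_mult_pos2[of k "a powr s"] by (simp add: zero_less_mult_iff)
  define w where "w A = (\<integral>\<^sup>+t\<in>A. exp (k * superdisc_profile s t) \<partial>lborel)" for A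
  define J where "J = {a..2*a}"
  have K: "K \<ge> 1" by (simp add: K_def)
  have c: "c \<ge> 0" using s p by (simp add: c_def)
  have split: "w {-1<..<1} = w ({-1<..<1} - J) + w J"
  proof -
    have "w {-1<..<1} = (\<integral>\<^sup>+t. ennreal (exp (k * superdisc_profile s t)) * indicator ({-1<..<1} - J) t
        + ennreal (exp (k * superdisc_profile s t)) * indicator J t \<partial>lborel)"
      unfolding w_def using a by (intro nn_integral_cong) (auto simp: indicator_def J_def)
    also have "\<dots> = w ({-1<..<1} - J) + w J"
      unfolding w_def by (rule nn_integral_add) (auto simp: J_def)
    finally show ?thesis .
  qed
  have "ennreal ((1 + (K - 1) * c) * k) * (\<integral>\<^sup>+x\<in>superdisc s. exp (k * x $ 2) \<partial>lborel)
      = ennreal (1 + (K - 1) * c) * (ennreal k * (\<integral>\<^sup>+x\<in>superdisc s. exp (k * x $ 2) \<partial>lborel))"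
    using K c \<open>k > 0\<close> by (simp add: ennreal_mult mult.assoc)
  also have "\<dots> \<le> ennreal (1 + (K - 1) * c) * w {-1<..<1}"
    unfolding w_def by (intro mult_left_mono nn_integral_superdisc_exp_le[OF s \<open>k > 0\<close>]) simp
  also have "\<dots> = w {-1<..<1} + ennreal (K - 1) * (ennreal c * w {-1<..<1})"
    using K c by (simp add: ennreal_plus ennreal_mult distrib_right mult.assoc)
  also have "\<dots> \<le> w {-1<..<1} + ennreal (K - 1) * w J"
    using superdisc_weight_concentration[OF s p a k]
    by (intro add_left_mono mult_left_mono) (simp_all add: w_def J_def c_def)
  also have "\<dots> = w ({-1<..<1} - J) + (1 + ennreal (K - 1)) * w J"
    by (simp add: split distrib_right add.assoc)
  also have "1 + ennreal (K - 1) = ennreal K"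
    using K by (simp add: ennreal_plus[symmetric] ennreal_1[symmetric] del: ennreal_plus ennreal_1)
  also have "w ({-1<..<1} - J) + ennreal K * w J
      \<le> (\<integral>\<^sup>+x\<in>frontier (superdisc s). exp (k * x $ 2) \<partial>hausdorff1)"
    unfolding w_def J_def K_def by (rule nn_integral_superdisc_boundary_exp_ge[OF s a])
  finally show ?thesis .
qed

text \<open>For the competitor \<open>exp (\<mu> x2)\<close> the three integrals in the quotient are multiples of the interior and the
boundary integral of \<open>exp (p \<mu> x2)\<close>, and the preceding lemma compares these two.\<close>

lemma robin_Lambda_superdisc_le:
  assumes s: "s > 1" and p: "p > 1" and lam: "\<mu> > 0" and a: "a = \<mu> powr (- 1 / s)" "2 * a < 1" and \<alpha>: "\<alpha> > 0"
  defines "c \<equiv> p * exp (- (p * 2 powr s) - p / s) / (2 * s)"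
  shows "robin_Lambda p (superdisc s) \<alpha>
    \<le> ereal (\<mu> powr p - \<alpha> * p * \<mu> * (1 + (sqrt (1 + (a powr (s - 1))\<^sup>2) - 1) * c))"
proof -
  define \<Omega> where "\<Omega> = superdisc s"
  define u :: "real ^ 2 \<Rightarrow> real" where "u x = exp (\<mu> * x $ 2)" for x
  define k where "k = p * \<mu>"
  define v :: "real ^ 2 \<Rightarrow> real" where "v x = exp (k * x $ 2)" for x
  define \<kappa> where "\<kappa> = (sqrt (1 + (a powr (s - 1))\<^sup>2) - 1) * c"
  have \<Omega>: "open \<Omega>" "bounded \<Omega>" "\<Omega> \<noteq> {}" and fin: "emeasure hausdorff1 (frontier \<Omega>) < \<infinity>"
    using s open_superdisc bounded_superdisc hausdorff1_frontier_superdisc_finite C1_domain_superdisc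
    by (auto simp: \<Omega>_def C1_domain_def)
  have [measurable]: "\<Omega> \<in> sets borel" "frontier \<Omega> \<in> sets borel" using \<Omega>(1) by auto
  have "k > 0" using p lam by (simp add: k_def)
  have "a > 0" using lam a by simp
  have "a powr s = \<mu> powr (- 1 / s * s)" by (simp only: a powr_powr)
  also have "- 1 / s * s = - 1" using s by simp
  finally have "a powr s = 1 / \<mu>" using lam by (simp add: powr_minus_divide)
  then have ka: "k * a powr s = p" using lam by (simp add: k_def)
  have "\<kappa> \<ge> 0" using s p by (simp add: \<kappa>_def c_def)
  have vc: "continuous_on UNIV v" unfolding v_def by (intro continuous_intros)
  then have [measurable]: "v \<in> borel_measurable borel" by (rule borel_measurable_continuous_onI)
  have nonzero: "\<not> (AE x in lebesgue_on \<Omega>. exp (f x) = 0)" for f :: "real ^ 2 \<Rightarrow> real"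
    using not_AE_False_lebesgue_on_open[OF \<Omega>(1,3)] by simp
  have le: "robin_Lambda p \<Omega> \<alpha> \<le> ereal (robin_quotient p \<Omega> \<alpha> u (grad u) u)"
  proof (rule robin_Lambda_le_quotient[OF _ \<Omega>(1,2) fin])
    show "smooth u" unfolding u_def by (rule smooth_exp_component)
    show "\<not> (AE x in lebesgue_on \<Omega>. u x = 0)" unfolding u_def by (rule nonzero)
  qed (use p in auto)
  have u_powr: "\<bar>u x\<bar> powr p = v x" for x
    by (simp add: u_def v_def k_def exp_powr_real mult_ac)
  have grad_powr: "norm (grad u x) powr p = \<mu> powr p * v x" for x
  proof -
    have "grad u x = axis 2 (\<mu> * u x)" unfolding u_def by (rule grad_exp_component)
    then have "norm (grad u x) = \<mu> * \<bar>u x\<bar>" using lam by (simp add: norm_eq_sqrt_inner inner_axis_axis abs_mult)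
    then show ?thesis using lam by (simp add: powr_mult u_powr)
  qed
  \<comment> \<open>the integrals \<open>I\<close> and \<open>B\<close> of the introduction\<close>
  define I where "I = (\<integral>x. v x \<partial>lebesgue_on \<Omega>)"
  define B where "B = (\<integral>x. v x \<partial>boundary_measure \<Omega>)"
  have v_pos: "v x > 0" for x by (simp add: v_def)
  have int: "integrable (lebesgue_on \<Omega>) v" "integrable (boundary_measure \<Omega>) v"
    using Lp_lebesgue_on_continuous[of 1, OF _ \<Omega>(1,2) vc]
      Lp_boundary_measure_continuous[of 1, OF _ \<Omega>(2) fin vc]
    by (auto simp: Lp_def integrable_norm_iff simp del: real_norm_def)
  have "I \<ge> 0" unfolding I_def using v_pos by (intro Bochner_Integration.integral_nonneg less_imp_le)
  moreover have "I \<noteq> 0"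
  proof
    assume "I = 0"
    then have "AE x in lebesgue_on \<Omega>. v x = 0"
      using integral_nonneg_eq_0_iff_AE[OF int(1)] v_pos by (simp add: I_def less_imp_le)
    with nonzero show False by (simp add: v_def)
  qed
  ultimately have "I > 0" by simp
  have I: "ennreal I = (\<integral>\<^sup>+x\<in>\<Omega>. v x \<partial>lborel)"
  proof -
    have "ennreal I = (\<integral>\<^sup>+x. v x \<partial>lebesgue_on \<Omega>)"
      unfolding I_def using nn_integral_eq_integral[OF int(1)] v_pos by (simp add: less_imp_le)
    also have "\<dots> = (\<integral>\<^sup>+x\<in>\<Omega>. v x \<partial>lebesgue)"
      by (intro nn_integral_restrict_space) auto
    finally show ?thesis by (simp add: nn_integral_completion)
  qed
  have B: "ennreal B = (\<integral>\<^sup>+x\<in>frontier \<Omega>. v x \<partial>hausdorff1)"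
  proof -
    have "ennreal B = (\<integral>\<^sup>+x. v x \<partial>boundary_measure \<Omega>)"
      unfolding B_def using nn_integral_eq_integral[OF int(2)] v_pos by (simp add: less_imp_le)
    also have "\<dots> = (\<integral>\<^sup>+x\<in>frontier \<Omega>. v x \<partial>hausdorff1)"
      unfolding boundary_measure_def by (intro nn_integral_restrict_space) auto
    finally show ?thesis .
  qed
  have "ennreal ((1 + \<kappa>) * k) * ennreal I \<le> ennreal B"
    unfolding I B using superdisc_boundary_interior_ratio[OF s _ \<open>a > 0\<close> a(2) ka] p
    by (simp add: v_def \<Omega>_def \<kappa>_def c_def)
  then have "ennreal ((1 + \<kappa>) * k * I) \<le> ennreal B"
    using \<open>I > 0\<close> \<open>\<kappa> \<ge> 0\<close> \<open>k > 0\<close> by (simp add: ennreal_mult)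
  moreover have "B \<ge> 0" unfolding B_def using v_pos by (intro Bochner_Integration.integral_nonneg less_imp_le)
  ultimately have "(1 + \<kappa>) * k * I \<le> B" by simp
  then have "\<alpha> * ((1 + \<kappa>) * k) \<le> \<alpha> * (B / I)"
    using \<alpha> \<open>I > 0\<close> by (intro mult_left_mono) (simp_all add: field_simps)
  moreover have "robin_quotient p \<Omega> \<alpha> u (grad u) u = (\<mu> powr p * I - \<alpha> * B) / I"
    unfolding robin_quotient_def u_powr grad_powr I_def B_def by simp
  then have "robin_quotient p \<Omega> \<alpha> u (grad u) u = \<mu> powr p - \<alpha> * (B / I)"
    using \<open>I > 0\<close> by (simp add: field_simps)
  ultimately have "robin_quotient p \<Omega> \<alpha> u (grad u) u \<le> \<mu> powr p - \<alpha> * p * \<mu> * (1 + \<kappa>)"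
    by (simp add: k_def mult_ac)
  with le show ?thesis
    unfolding \<Omega>_def \<kappa>_def by (meson ereal_less_eq(3) order_trans)
qed

theorem corollary4:
  fixes p q r :: real
  assumes "p > 1" and "q = p / (p - 1)" and "r < q"
  shows "\<exists>(\<Omega> :: (real ^ 2) set) c. bounded \<Omega> \<and> C1_domain \<Omega> \<and> c > 0 \<and>
           (\<forall>\<^sub>F \<alpha> in at_top.
              \<bar>robin_Lambda p \<Omega> \<alpha> - ereal ((1 - p) * \<alpha> powr q)\<bar> \<ge> ereal (c * \<alpha> powr r))"
proof -
  have p: "p > 1" by fact
  have q1: "q - 1 = 1 / (p - 1)" using assms(1,2) by (simp add: field_simps)
  have qp: "(q - 1) * p = q" using assms(1,2) q1 by simp
  have "1 / (p - 1) > 0" using p by simp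
  then have "q > 1" unfolding q1[symmetric] by simp
  \<comment> \<open>chosen so that \<open>2 (q - 1) (s - 1) = q - r\<close>\<close>
  define s where "s = 1 + (q - r) / (2 * (q - 1))"
  have s: "s > 1" using assms(3) \<open>q > 1\<close> by (simp add: s_def)
  define c where "c = p * exp (- (p * 2 powr s) - p / s) / (2 * s)"
  have "c > 0" using p s by (simp add: c_def)
  \<comment> \<open>the width of the boundary region in which the competitor concentrates\<close>
  define a where "a \<alpha> = \<alpha> powr (- (q - 1) / s)" for \<alpha>
  have exponent: "r \<le> q - 2 * ((q - 1) * (s - 1) / s)"
  proof -
    have "(2 * (q - 1)) * ((q - r) / (2 * (q - 1))) = q - r"
      using \<open>q > 1\<close> by (subst times_divide_eq_right, subst nonzero_mult_div_cancel_left) auto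
    then have "2 * ((q - 1) * (s - 1)) = q - r" by (simp only: s_def add_diff_cancel_left' mult.assoc)
    moreover have "(q - 1) * (s - 1) / s \<le> (q - 1) * (s - 1)"
      using s \<open>q > 1\<close> by (simp add: divide_le_eq mult_left_le_one_le)
    ultimately show ?thesis by linarith
  qed
  have bound: "ereal (p * c / 3 * \<alpha> powr r) \<le> \<bar>robin_Lambda p (superdisc s) \<alpha> - ereal ((1 - p) * \<alpha> powr q)\<bar>"
    if \<alpha>: "\<alpha> \<ge> 1" and small: "a \<alpha> < 1 / 2" for \<alpha>
  proof -
    define \<mu> where "\<mu> = \<alpha> powr (q - 1)"
    define m where "m = a \<alpha> powr (s - 1)"
    have "\<mu> > 0" using \<alpha> by (simp add: \<mu>_def)
    have lam_p: "\<mu> powr p = \<alpha> powr q" by (simp add: \<mu>_def powr_powr qp)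
    have lam_\<alpha>: "\<alpha> * \<mu> = \<alpha> powr q" using \<alpha> by (simp add: \<mu>_def powr_mult_base)
    have a_lam: "a \<alpha> = \<mu> powr (- 1 / s)"
    proof -
      have "- (q - 1) / s = (q - 1) * (- 1 / s)" using s by (simp add: field_simps)
      then show ?thesis by (simp only: a_def \<mu>_def powr_powr)
    qed
    have "0 < a \<alpha>" using \<alpha> by (simp add: a_def)
    have m: "0 \<le> m" "m \<le> 1"
      using small powr_mono2[of "s - 1" "a \<alpha>" 1] s \<open>0 < a \<alpha>\<close> by (auto simp: m_def)
    \<comment> \<open>from \<open>(1 + m\<^sup>2 / 3)\<^sup>2 = 1 + 2 m\<^sup>2 / 3 + m\<^sup>4 / 9\<close> and \<open>m \<le> 1\<close>\<close>
    have gain: "m\<^sup>2 / 3 \<le> sqrt (1 + m\<^sup>2) - 1"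
    proof -
      have "m\<^sup>2 \<le> 1" using m by (simp add: power_le_one)
      then have "m\<^sup>2 * m\<^sup>2 \<le> m\<^sup>2" by (intro mult_right_le_one_le) auto
      moreover have square: "(1 + y / 3)\<^sup>2 = 1 + 2 / 3 * y + y * y / 9" for y :: real
        by (simp add: power2_eq_square algebra_simps)
      moreover have "m\<^sup>2 \<ge> 0" by simp
      ultimately have "(1 + m\<^sup>2 / 3)\<^sup>2 \<le> 1 + m\<^sup>2"
        unfolding square by linarith
      then have "1 + m\<^sup>2 / 3 \<le> sqrt (1 + m\<^sup>2)" by (rule real_le_rsqrt)
      then show ?thesis by simp
    qed
    have "\<alpha> powr r \<le> \<alpha> powr q * m\<^sup>2"
    proof -
      have "m\<^sup>2 = \<alpha> powr (- (q - 1) / s * (s - 1) * 2)"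
        using \<alpha> by (simp add: m_def a_def powr_powr powr_power mult_ac)
      also have "- (q - 1) / s * (s - 1) * 2 = - (2 * ((q - 1) * (s - 1) / s))"
        using s by (simp add: field_simps)
      finally have "\<alpha> powr q * m\<^sup>2 = \<alpha> powr (q - 2 * ((q - 1) * (s - 1) / s))"
        by (simp only: powr_add[symmetric] diff_conv_add_uminus)
      then show ?thesis using exponent \<alpha> by (simp add: powr_mono)
    qed
    then have "p * c / 3 * \<alpha> powr r \<le> p * c / 3 * (\<alpha> powr q * m\<^sup>2)"
      using p \<open>c > 0\<close> by (intro mult_left_mono) auto
    also have "\<dots> = p * c * \<alpha> powr q * (m\<^sup>2 / 3)" by simp
    also have "\<dots> \<le> p * c * \<alpha> powr q * (sqrt (1 + m\<^sup>2) - 1)"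
      using p \<open>c > 0\<close> gain by (intro mult_left_mono) auto
    finally have diff: "p * c / 3 * \<alpha> powr r \<le> p * c * \<alpha> powr q * (sqrt (1 + m\<^sup>2) - 1)" .
    have "robin_Lambda p (superdisc s) \<alpha> \<le> ereal (\<mu> powr p - \<alpha> * p * \<mu> * (1 + (sqrt (1 + m\<^sup>2) - 1) * c))"
      unfolding m_def c_def
      by (rule robin_Lambda_superdisc_le[OF s p \<open>\<mu> > 0\<close> a_lam]) (use small \<alpha> in auto)
    also have "\<mu> powr p - \<alpha> * p * \<mu> * (1 + (sqrt (1 + m\<^sup>2) - 1) * c)
        = \<alpha> powr q - p * (\<alpha> * \<mu>) * (1 + (sqrt (1 + m\<^sup>2) - 1) * c)"
      by (simp add: lam_p mult_ac)
    also have "\<dots> = (1 - p) * \<alpha> powr q - p * c * \<alpha> powr q * (sqrt (1 + m\<^sup>2) - 1)"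
      unfolding lam_\<alpha> by (simp add: algebra_simps)
    finally have "robin_Lambda p (superdisc s) \<alpha> \<le> ereal ((1 - p) * \<alpha> powr q - p * c / 3 * \<alpha> powr r)"
      using diff by (rule_tac order_trans) auto
    \<comment> \<open>this includes \<open>L = - \<infinity>\<close>\<close>
    moreover have "ereal d \<le> \<bar>L - ereal x\<bar>" if "L \<le> ereal (x - d)" for L x d
      using that by (cases L) auto
    ultimately show ?thesis by blast
  qed
  have "(a \<longlongrightarrow> 0) at_top"
    unfolding a_def[abs_def] using s \<open>q > 1\<close> by (intro tendsto_neg_powr filterlim_ident) (simp add: field_simps)
  then have "\<forall>\<^sub>F \<alpha> in at_top. a \<alpha> < 1 / 2" by (rule order_tendstoD) simp
  then have "\<forall>\<^sub>F \<alpha> in at_top. ereal (p * c / 3 * \<alpha> powr r)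
      \<le> \<bar>robin_Lambda p (superdisc s) \<alpha> - ereal ((1 - p) * \<alpha> powr q)\<bar>"
    using eventually_ge_at_top[of 1] by eventually_elim (rule bound)
  moreover have "p * c / 3 > 0" using p \<open>c > 0\<close> by simp
  ultimately show ?thesis
    using bounded_superdisc[of s] C1_domain_superdisc[OF s] s
    by (intro exI[of _ "superdisc s"] exI[of _ "p * c / 3"]) auto
qed

end
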